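(* Let $\Omega,\mathsf D,f,b,g,w,p,\mathcal N,\boldsymbol{\mathsf N}$ be as in the context, with $\mathcal N:\mathbb R\to\mathbb R$ locally Lipschitz continuous, and assume that the set $\mathbf S_\star\subset\mathbb R$ defined in the context has at least two distinct elements (possibly infinitely many). Then for each $r_i\in\mathbf S_\star$ there exists $\lambda_{i,*}>0$ such that for all $\lambda>\lambda_{i,*}$, with $\mathcal I_{i,\lambda}=[-\lambda^{\frac{1-p}{4p}},\lambda^{\frac{1-p}{4p}}]$, the formula $$\boldsymbol{\mathsf T}_{i,\lambda}(\theta)=\boldsymbol{\mathsf N}[(r_i+\theta)\Phi_\lambda+\Psi_\lambda]-r_i,\qquad\theta\in\mathcal I_{i,\lambda},$$ defines a mapping $\boldsymbol{\mathsf T}_{i,\lambda}:\mathcal I_{i,\lambda}\to\mathcal I_{i,\lambda}$ that admits a unique fixed point $\theta_{i,\lambda}$.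
   Context: Standing assumptions. $\Omega\subset\mathbb R^m$ ($m\ge1$) is a bounded smooth domain with unit outward normal $\vec\nu$; $|\Omega|$ is its Lebesgue measure. $\mathsf D=(D_{ij})_{m\times m}$ is symmetric with $D_{ij}\in C^1(\overline\Omega;\mathbb R)$ and $\sum_{i,j}D_{ij}(x)z_iz_j\ge\mathfrak D|z|^2$ for all $x\in\overline\Omega$, $z\in\mathbb R^m$, with a constant $\mathfrak D>0$. $f\in C^0(\overline\Omega;(0,\infty))$, $b\in C^0(\partial\Omega;[0,\infty))$, $g\in C^0(\partial\Omega;\mathbb R)$. The weight $w\in L^p(\Omega)$ for some $p>1$ (if $p=\infty$, set $1/p=0$) has no sign restriction and satisfies $\int_\Omega w\,dy=1$. The nonlocal term is one of two types: type I: $\boldsymbol{\mathsf N}[u]=\int_\Omega w(y)\mathcal N(u(y))\,dy$; type II: $\boldsymbol{\mathsf N}[u]=\mathcal N\big(\int_\Omega w(y)u(y)\,dy\big)$. The set $\mathbf S_\star$ consists of all $r\in\mathbb R$ such that $r=\mathcal N(r)$ and there exist $\delta_r>0$ and a constant $\mathcal L_r$ with $$0<\mathcal L_r<\frac{|\Omega|^{\frac1p-1}}{\|w\|_{L^p(\Omega)}}$$ such that $|\mathcal N(s_1)-\mathcal N(s_2)|\le\mathcal L_r|s_1-s_2|$ for all $s_1,s_2\in[r-\delta_r,r+\delta_r]$. For $\lambda>0$, $\Phi_\lambda$ and $\Psi_\lambda$ are the unique classical solutions of $$-\nabla\cdot(\mathsf D\nabla\Phi_\lambda)+\lambda f(\Phi_\lambda-1)=0\text{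 in }\Omega,\quad \Phi_\lambda+b\,\frac{\partial\Phi_\lambda}{\partial\vec\nu}=0\text{ on }\partial\Omega,$$ $$-\nabla\cdot(\mathsf D\nabla\Psi_\lambda)+\lambda f\Psi_\lambda=0\text{ in }\Omega,\quad \Psi_\lambda+b\,\frac{\partial\Psi_\lambda}{\partial\vec\nu}=g\text{ on }\partial\Omega.$$ *)

theory Defs
  imports "HOL-Analysis.Analysis" "HOL-Probability.Essential_Supremum"
begin

section \<open>Smooth functions and differential operators\<close>

definition grad :: "(real^'n \<Rightarrow> real) \<Rightarrow> real^'n \<Rightarrow> real^'n" where
  "grad u x = (\<chi> i. frechet_derivative u (at x) (axis i 1))"

definition divergence :: "(real^'n \<Rightarrow> real^'n) \<Rightarrow> real^'n \<Rightarrow> real" where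
  "divergence F x = trace (jacobian F (at x))"

text \<open>The classes \<open>C\<^sup>k\<close> and \<open>C\<^sup>\<infinity>\<close>, for use on open sets only.\<close>

fun Ck_on :: "nat \<Rightarrow> (real^'n) set \<Rightarrow> (real^'n \<Rightarrow> real) \<Rightarrow> bool" where
  "Ck_on 0 S u \<longleftrightarrow> continuous_on S u"
| "Ck_on (Suc k) S u \<longleftrightarrow>
     (\<forall>x\<in>S. u differentiable (at x)) \<and> (\<forall>i. Ck_on k S (\<lambda>x. grad u x $ i))"

definition smooth_on :: "(real^'n) set \<Rightarrow> (real^'n \<Rightarrow> real) \<Rightarrow> bool" where
  "smooth_on S u \<longleftrightarrow> (\<forall>k. Ck_on k S u)"

text \<open>\<open>C\<^sup>1\<close> up to the boundary: \<open>u\<close> is continuous on the closure of the open set \<open>\<Omega>\<close>, is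
  \<open>C\<^sup>1\<close> in \<open>\<Omega>\<close>, and its gradient extends continuously to the closure.\<close>

definition C1_closure :: "(real^'n) set \<Rightarrow> (real^'n \<Rightarrow> real) \<Rightarrow> bool" where
  "C1_closure \<Omega> u \<longleftrightarrow> continuous_on (closure \<Omega>) u \<and> Ck_on 1 \<Omega> u \<and>
     (\<exists>G. continuous_on (closure \<Omega>) G \<and> (\<forall>x\<in>\<Omega>. G x = grad u x))"

section \<open>Bounded smooth domains\<close>

text \<open>\<open>\<rho>\<close> is a smooth defining function of \<open>\<Omega>\<close> on the neighbourhood \<open>U\<close> of \<open>x\<close>. Since its gradient
  does not vanish, \<open>{y \<in> U. \<rho> y = 0}\<close> is a smooth hypersurface, it is the boundary of \<open>\<Omega>\<close> in \<open>U\<close>,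
  \<open>\<Omega>\<close> lies on one side of it, and the gradient of \<open>\<rho>\<close> points out of \<open>\<Omega>\<close> along it.\<close>

definition local_defining_function ::
  "(real^'n) set \<Rightarrow> real^'n \<Rightarrow> (real^'n) set \<Rightarrow> (real^'n \<Rightarrow> real) \<Rightarrow> bool" where
  "local_defining_function \<Omega> x U \<rho> \<longleftrightarrow>
     open U \<and> x \<in> U \<and> smooth_on U \<rho> \<and> (\<forall>y\<in>U. grad \<rho> y \<noteq> 0) \<and> \<Omega> \<inter> U = {y\<in>U. \<rho> y < 0}"

definition bounded_smooth_domain :: "(real^'n) set \<Rightarrow> bool" where
  "bounded_smooth_domain \<Omega> \<longleftrightarrow>
     open \<Omega> \<and> connected \<Omega> \<and> \<Omega> \<noteq> {} \<and> bounded \<Omega> \<and>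
     (\<forall>x\<in>frontier \<Omega>. \<exists>U \<rho>. local_defining_function \<Omega> x U \<rho>)"

definition unit_outward_normal :: "(real^'n) set \<Rightarrow> real^'n \<Rightarrow> real^'n \<Rightarrow> bool" where
  "unit_outward_normal \<Omega> x v \<longleftrightarrow>
     (\<exists>U \<rho>. local_defining_function \<Omega> x U \<rho> \<and> v = grad \<rho> x /\<^sub>R norm (grad \<rho> x))"

section \<open>The boundary value problems\<close>

text \<open>The normal derivative at a boundary point \<open>x\<close> is the one-sided derivative at \<open>x\<close> along the
  normal line, taken from inside \<open>\<Omega>\<close>; it equals the inner product of gradient and normal
  whenever \<open>u\<close> is \<open>C\<^sup>1\<close> up to the boundary.\<close>

definition has_normal_derivative ::
  "(real^'n \<Rightarrow> real) \<Rightarrow> real^'n \<Rightarrow> real^'n \<Rightarrow> real \<Rightarrow> bool" where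
  "has_normal_derivative u x v d \<longleftrightarrow>
     ((\<lambda>t. u (x + t *\<^sub>R v)) has_real_derivative d) (at_left 0)"

text \<open>Classical solutions of \<open>- div (D grad u) + h(x, u) = 0\<close> in \<open>\<Omega>\<close> and \<open>u + b du/d\<nu> = g\<close> on
  the boundary. As \<open>b\<close> and \<open>g\<close> are merely continuous and \<open>b\<close> may vanish, \<open>u\<close> is not required to
  be \<open>C\<^sup>1\<close> up to the boundary: it is \<open>C\<^sup>2\<close> in \<open>\<Omega>\<close>, continuous on the closure, and has a normal
  derivative wherever the boundary condition involves one. At points with \<open>b x = 0\<close> the condition
  is the Dirichlet condition \<open>u x = g x\<close>.\<close>

definition classical_solution ::
  "(real^'n) set \<Rightarrow> (real^'n \<Rightarrow> real^'n) \<Rightarrow> (real^'n \<Rightarrow> real^'n^'n) \<Rightarrow> (real^'n \<Rightarrow> real \<Rightarrow> real) \<Rightarrow>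
   (real^'n \<Rightarrow> real) \<Rightarrow> (real^'n \<Rightarrow> real) \<Rightarrow> (real^'n \<Rightarrow> real) \<Rightarrow> bool" where
  "classical_solution \<Omega> \<nu> D h b g u \<longleftrightarrow>
     Ck_on 2 \<Omega> u \<and> continuous_on (closure \<Omega>) u \<and>
     (\<forall>x\<in>\<Omega>. - divergence (\<lambda>y. D y *v grad u y) x + h x (u x) = 0) \<and>
     (\<forall>x\<in>frontier \<Omega>.
        if b x = 0 then u x = g x
        else \<exists>d. has_normal_derivative u x (\<nu> x) d \<and> u x + b x * d = g x)"

section \<open>Lebesgue spaces and the nonlocal term\<close>

text \<open>Exponents range over \<open>[1, \<infinity>]\<close>. As \<open>inverse \<infinity> = 0\<close> in \<^typ>\<open>ennreal\<close>, the definition of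
  \<open>recip\<close> includes the convention \<open>1/p = 0\<close> for \<open>p = \<infinity>\<close>.\<close>

definition recip :: "ennreal \<Rightarrow> real" where
  "recip p = enn2real (inverse p)"

definition in_Lp :: "(real^'n) set \<Rightarrow> ennreal \<Rightarrow> (real^'n \<Rightarrow> real) \<Rightarrow> bool" where
  "in_Lp \<Omega> p w \<longleftrightarrow> w \<in> borel_measurable (lebesgue_on \<Omega>) \<and>
     (if p = \<infinity> then esssup (lebesgue_on \<Omega>) (\<lambda>x. ennreal \<bar>w x\<bar>) < \<infinity>
      else integrable (lebesgue_on \<Omega>) (\<lambda>x. \<bar>w x\<bar> powr enn2real p))"

definition Lp_norm :: "(real^'n) set \<Rightarrow> ennreal \<Rightarrow> (real^'n \<Rightarrow> real) \<Rightarrow> real" where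
  "Lp_norm \<Omega> p w =
     (if p = \<infinity> then enn2real (esssup (lebesgue_on \<Omega>) (\<lambda>x. ennreal \<bar>w x\<bar>))
      else (LINT x|lebesgue_on \<Omega>. \<bar>w x\<bar> powr enn2real p) powr recip p)"

datatype nonlocal_type = TypeI | TypeII

fun nonlocal ::
  "nonlocal_type \<Rightarrow> (real^'n) set \<Rightarrow> (real^'n \<Rightarrow> real) \<Rightarrow> (real \<Rightarrow> real) \<Rightarrow> (real^'n \<Rightarrow> real) \<Rightarrow> real" where
  "nonlocal TypeI \<Omega> w N u = (LINT y|lebesgue_on \<Omega>. w y * N (u y))"
| "nonlocal TypeII \<Omega> w N u = N (LINT y|lebesgue_on \<Omega>. w y * u y)"

text \<open>The Bochner integral of a non-integrable function is \<open>0\<close> by convention; this predicate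
  states that the integral in the nonlocal term actually exists.\<close>

fun nonlocal_defined ::
  "nonlocal_type \<Rightarrow> (real^'n) set \<Rightarrow> (real^'n \<Rightarrow> real) \<Rightarrow> (real \<Rightarrow> real) \<Rightarrow> (real^'n \<Rightarrow> real) \<Rightarrow> bool" where
  "nonlocal_defined TypeI \<Omega> w N u \<longleftrightarrow> integrable (lebesgue_on \<Omega>) (\<lambda>y. w y * N (u y))"
| "nonlocal_defined TypeII \<Omega> w N u \<longleftrightarrow> integrable (lebesgue_on \<Omega>) (\<lambda>y. w y * u y)"

definition S_star :: "(real^'n) set \<Rightarrow> ennreal \<Rightarrow> (real^'n \<Rightarrow> real) \<Rightarrow> (real \<Rightarrow> real) \<Rightarrow> real set" where
  "S_star \<Omega> p w N = {r. r = N r \<and>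
     (\<exists>\<delta>>0. \<exists>L. 0 < L \<and> L < measure lebesgue \<Omega> powr (recip p - 1) / Lp_norm \<Omega> p w \<and>
        (\<forall>s\<^sub>1\<in>{r-\<delta>..r+\<delta>}. \<forall>s\<^sub>2\<in>{r-\<delta>..r+\<delta>}. \<bar>N s\<^sub>1 - N s\<^sub>2\<bar> \<le> L * \<bar>s\<^sub>1 - s\<^sub>2\<bar>))}"

text \<open>The interval with endpoints \<open>\<plusminus> \<lambda> powr ((1 - p) / (4 p))\<close>; the exponent is written as
  \<open>(1/p - 1) / 4\<close> to cover \<open>p = \<infinity>\<close>.\<close>

definition I_int :: "ennreal \<Rightarrow> real \<Rightarrow> real set" where
  "I_int p lam = {- (lam powr ((recip p - 1) / 4)) .. lam powr ((recip p - 1) / 4)}"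

definition T_map ::
  "nonlocal_type \<Rightarrow> (real^'n) set \<Rightarrow> (real^'n \<Rightarrow> real) \<Rightarrow> (real \<Rightarrow> real) \<Rightarrow>
   (real^'n \<Rightarrow> real) \<Rightarrow> (real^'n \<Rightarrow> real) \<Rightarrow> real \<Rightarrow> real \<Rightarrow> real" where
  "T_map ty \<Omega> w N \<Phi> \<Psi> r \<theta> = nonlocal ty \<Omega> w N (\<lambda>y. (r + \<theta>) * \<Phi> y + \<Psi> y) - r"

end

theory Submission
  imports Defs
begin

text \<open>By the maximum principle \<open>0 \<le> \<Phi>\<^sub>\<lambda> \<le> 1\<close> and \<open>\<bar>\<Psi>\<^sub>\<lambda>\<bar> \<le> max \<bar>g\<bar>\<close>. Comparison with a
  quadratic barrier on a ball of radius \<open>\<delta>\<close> inside the domain shows that \<open>\<Phi>\<^sub>\<lambda> - 1\<close> and \<open>\<Psi>\<^sub>\<lambda>\<close> are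
  \<open>O(1 / (\<lambda> \<delta>\<^sup>2))\<close> at its centre; note that \<open>\<Phi>\<^sub>\<lambda> - 1\<close> solves the problem of \<open>\<Psi>\<^sub>\<lambda>\<close> with boundary
  datum \<open>-1\<close>. With \<open>\<delta> = \<lambda> powr (-5/16)\<close> the error is \<open>O(\<lambda> powr (-3/8))\<close> off the boundary layer of
  width \<open>\<delta>\<close>. The layer has measure \<open>O(\<delta>)\<close>, so by Hoelder's inequality \<open>\<bar>w\<bar>\<close> has integral
  \<open>O(\<lambda> powr (-5 s/16))\<close> over it, where \<open>s = 1 - 1/p\<close>. Both errors are \<open>o(\<lambda> powr (-s/4))\<close>, the radius
  of the interval, and off the layer \<open>N\<close> contributes the factor
  \<open>L \<parallel>w\<parallel> \<bar>\<Omega>\<bar> powr s < 1\<close>, which makes the map a contraction of the interval into itself.\<close>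

section \<open>The measure of the boundary layer\<close>

text \<open>The exponent 5/16 reconciles two opposing demands. With
  \<open>\<delta> = \<lambda> powr (-k)\<close> the interior error has order
  \<open>\<lambda> powr (2 * k - 1)\<close>. It must beat \<open>\<lambda> powr (-s/4)\<close> for
  every \<open>s \<le> 1\<close>, which asks for k < 3/8. The layer error
  \<open>\<delta> powr s\<close> must beat the same power, which asks for k > 1/4. The value 5/16 is
  the midpoint. The obstacle is the low regularity at the boundary: only a one-sided normal
  derivative exists there, and only where \<open>b\<close> does not vanish. The estimates therefore
  rest on comparison at maximum points, and the divergence is expanded first so that second order
  conditions at an interior maximum apply. The small Lipschitz constant of \<open>N\<close> near
  \<open>r\<close> is at hand only off the layer. On the layer the argument of \<open>N\<close>
  merely stays in a fixed bounded interval, by the maximum principle, and \<open>N\<close> has some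
  larger constant \<open>L'\<close> there. This is harmless because \<open>L'\<close> multiplies
  only the mass of \<open>\<bar>w\<bar>\<close> on the layer. For type II the weighted average
  itself lies close to \<open>r\<close>.\<close>

lemma has_derivative_grad:
  fixes u :: "real^'n \<Rightarrow> real"
  assumes "u differentiable (at x)"
  shows "(u has_derivative (\<lambda>h. grad u x \<bullet> h)) (at x)"
proof -
  have d: "(u has_derivative frechet_derivative u (at x)) (at x)"
    using assms frechet_derivative_works by blast
  have "frechet_derivative u (at x) h = grad u x \<bullet> h" for h
  proof -
    interpret bounded_linear "frechet_derivative u (at x)"
      using d by (rule has_derivative_bounded_linear)
    have "frechet_derivative u (at x) h = frechet_derivative u (at x) (\<Sum>i\<in>UNIV. h $ i *\<^sub>R axis i 1)"
      using basis_expansion[of h] by (simp add: scalar_mult_eq_scaleR)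
    also have "\<dots> = (\<Sum>i\<in>UNIV. h $ i * grad u x $ i)"
      by (simp add: sum scaleR grad_def)
    finally show ?thesis by (simp add: inner_vec_def mult.commute)
  qed
  then have "frechet_derivative u (at x) = (\<lambda>h. grad u x \<bullet> h)" by blast
  then show ?thesis using d by simp
qed

lemma lmeasurable_thickening:
  fixes E :: "'a::euclidean_space set"
  assumes "bounded E"
  shows "(\<Union>y\<in>E. ball y \<delta>) \<in> lmeasurable"
proof (rule lmeasurable_open)
  obtain R where R: "\<And>y. y \<in> E \<Longrightarrow> norm y \<le> R" using assms unfolding bounded_iff by blast
  show "bounded (\<Union>y\<in>E. ball y \<delta>)"
    unfolding bounded_iff
  proof (intro exI[of _ "R + \<delta>"] ballI)
    fix x assume "x \<in> (\<Union>y\<in>E. ball y \<delta>)"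
    then obtain y where "y \<in> E" "dist y x < \<delta>" by auto
    then show "norm x \<le> R + \<delta>"
      using R[of y] norm_triangle_sub[of x y] by (simp add: dist_norm norm_minus_commute)
  qed
qed auto

text \<open>Translates of the thickened set along \<open>v\<close> by multiples of \<open>2 C \<delta>\<close> are disjoint. About
  \<open>1 / \<delta>\<close> of them fit into a fixed ball, which bounds the measure without Fubini's theorem.\<close>

lemma measure_thickening_le:
  fixes E :: "'a::euclidean_space set"
  assumes "bounded E" and C: "C > 0" and v: "norm v = 1"
    and transversal: "\<And>x y t. x \<in> E \<Longrightarrow> y \<in> E \<Longrightarrow> \<bar>t\<bar> \<le> C * norm (y - x - t *\<^sub>R v)"
  shows "\<exists>K>0. \<forall>\<delta>. 0 < \<delta> \<longrightarrow> \<delta> \<le> 1 \<longrightarrow> measure lebesgue (\<Union>y\<in>E. ball y \<delta>) \<le> K * \<delta>"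
proof -
  obtain R where R: "R > 0" "\<And>y. y \<in> E \<Longrightarrow> norm y \<le> R"
    using \<open>bounded E\<close> bounded_pos by blast
  define V where "V = measure lebesgue (ball (0::'a) (R + 2 + 2 * C))"
  have V: "V \<ge> 0" by (simp add: V_def)
  have "measure lebesgue (\<Union>y\<in>E. ball y \<delta>) \<le> (2 * C * V + 1) * \<delta>" if \<delta>: "0 < \<delta>" "\<delta> \<le> 1" for \<delta>
  proof -
    define A where "A = (\<Union>y\<in>E. ball y \<delta>)"
    \<comment> \<open>Points of \<open>A\<close> lie within \<open>\<delta>\<close> of
      \<open>E\<close>. If two translates met, two points of \<open>E\<close> would differ from a
      multiple of \<open>v\<close> by less than \<open>2 * \<delta>\<close>, and
      \<open>transversal\<close> would make that multiple smaller than \<open>t\<close>.\<close>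
    define t where "t = 2 * C * \<delta>"
    have t: "t > 0" "t \<le> 2 * C" using C \<delta> by (auto simp: t_def)
    \<comment> \<open>Rounding up gives \<open>1 \<le> k * t \<le> 1 + 2 * C\<close>: the lower
      bound converts \<open>k\<close> disjoint copies in a ball of measure \<open>V\<close> into the
      bound \<open>t * V\<close>, the upper bound keeps all copies inside the ball of radius
      \<open>R + 2 + 2 * C\<close>.\<close>
    define k where "k = nat \<lceil>1 / t\<rceil>"
    have k: "1 / t \<le> real k" "real k < 1 / t + 1"
      using t(1) by (simp_all add: k_def) linarith+
    have kt: "real k * t \<ge> 1" "real k * t \<le> 1 + 2 * C"
      using k t by (simp_all add: field_simps)
    have A: "A \<in> lmeasurable" unfolding A_def by (rule lmeasurable_thickening) fact
    define B where "B i = (+) ((real i * t) *\<^sub>R v) ` A" for i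
    have B: "B i \<in> lmeasurable" "measure lebesgue (B i) = measure lebesgue A" for i
      using A by (simp_all add: B_def measurable_translation measure_translation)
    have key: "B i \<inter> B j = {}" if ij: "i < j" for i j
    proof (rule ccontr)
      assume "B i \<inter> B j \<noteq> {}"
      then obtain a a' where a: "a \<in> A" "a' \<in> A" "(real i * t) *\<^sub>R v + a = (real j * t) *\<^sub>R v + a'"
        by (auto simp: B_def)
      then obtain y y' where y: "y \<in> E" "y' \<in> E" "dist y a < \<delta>" "dist y' a' < \<delta>"
        by (auto simp: A_def)
      have eq: "y - y' - ((real j - real i) * t) *\<^sub>R v = (y - a) - (y' - a')"
        using a(3) by (simp add: algebra_simps)
      have "norm (y - y' - ((real j - real i) * t) *\<^sub>R v) < 2 * \<delta>"
        unfolding eq using y norm_triangle_ineq4[of "y - a" "y' - a'"] by (simp add: dist_norm)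
      then have "C * norm (y - y' - ((real j - real i) * t) *\<^sub>R v) < t"
        using C by (simp add: t_def)
      moreover have "t \<le> (real j - real i) * t"
        using t(1) ij by simp
      ultimately show False
        using transversal[OF y(2,1), of "(real j - real i) * t"] by linarith
    qed
    then have "disjoint_family_on B {..<k}"
      unfolding disjoint_family_on_def by (metis inf_commute linorder_neqE_nat)
    then have "measure lebesgue (\<Union>i<k. B i) = (\<Sum>i<k. measure lebesgue (B i))"
      using B(1) fmeasurableD2[OF B(1)] by (intro measure_finite_Union) (auto simp del: emeasure_completion)
    then have "real k * measure lebesgue A = measure lebesgue (\<Union>i<k. B i)"
      by (simp add: B)
    also have "\<dots> \<le> V"
      unfolding V_def
    proof (rule measure_mono_fmeasurable)
      show "(\<Union>i<k. B i) \<subseteq> ball 0 (R + 2 + 2 * C)"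
      proof safe
        fix i x assume i: "i < k" and "x \<in> B i"
        then obtain a y where a: "x = (real i * t) *\<^sub>R v + a" "y \<in> E" "dist y a < \<delta>"
          by (auto simp: A_def B_def)
        have "norm x \<le> real i * t + norm a"
          using norm_triangle_ineq[of "(real i * t) *\<^sub>R v" a] a(1) v t by simp
        moreover have "real i * t < real k * t" using i t by simp
        moreover have "norm a < R + 1"
          using R(2)[OF a(2)] a(3) \<delta> norm_triangle_sub[of a y]
          by (simp add: dist_norm norm_minus_commute)
        ultimately show "x \<in> ball 0 (R + 2 + 2 * C)" using kt(2) by simp
      qed
      show "(\<Union>i<k. B i) \<in> sets lebesgue" using B(1) by (auto simp: fmeasurable_def)
    qed auto
    finally have "real k * measure lebesgue A \<le> V" .
    then have "t * (real k * measure lebesgue A) \<le> t * V"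
      using t by (intro mult_left_mono) auto
    moreover have "1 * measure lebesgue A \<le> (real k * t) * measure lebesgue A"
      using kt by (intro mult_right_mono) auto
    ultimately have "measure lebesgue A \<le> t * V" by (simp add: mult_ac)
    also have "\<dots> \<le> (2 * C * V + 1) * \<delta>"
      using \<delta> by (simp add: t_def algebra_simps)
    finally show ?thesis by (simp add: A_def)
  qed
  moreover have "2 * C * V + 1 > 0" using C V by (simp add: add_nonneg_pos)
  ultimately show ?thesis by blast
qed

text \<open>A local defining function only prescribes where it is negative. Since
  \<open>\<Omega>\<close> is open, a frontier point lies outside it, which excludes a negative
  value; a positive value would persist nearby, although points of \<open>\<Omega>\<close>
  accumulate there.\<close>

lemma frontier_defining_function_zero:
  assumes "open \<Omega>" "local_defining_function \<Omega> x U \<rho>" "y \<in> frontier \<Omega>" "y \<in> U"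
  shows "\<rho> y = 0"
proof (rule antisym)
  have U: "open U" "\<Omega> \<inter> U = {y\<in>U. \<rho> y < 0}" and d: "\<rho> differentiable (at y)"
    using assms by (auto simp: local_defining_function_def smooth_on_def dest: spec[of _ "Suc 0"])
  have "y \<notin> \<Omega>" using assms by (simp add: frontier_def interior_open)
  then show "0 \<le> \<rho> y" using U assms by (metis (mono_tags, lifting) IntE mem_Collect_eq not_less)
  show "\<rho> y \<le> 0"
  proof (rule ccontr)
    assume "\<not> \<rho> y \<le> 0"
    then have "\<forall>\<^sub>F z in at y. \<rho> z > 0"
      using differentiable_imp_continuous_within[OF d]
      by (intro order_tendstoD) (auto simp: continuous_within)
    then obtain e where e: "e > 0" "\<And>z. z \<noteq> y \<Longrightarrow> dist z y < e \<Longrightarrow> \<rho> z > 0"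
      unfolding eventually_at by auto
    obtain e' where e': "e' > 0" "ball y e' \<subseteq> U" using U(1) assms(4) open_contains_ball by blast
    have "y \<in> closure \<Omega>" using assms by (simp add: frontier_def)
    then obtain z where z: "z \<in> \<Omega>" "dist z y < min e e'"
      using e e' closure_approachable[of y \<Omega>] by (metis min_less_iff_conj)
    then have "z \<in> \<Omega> \<inter> U" using e' by (auto simp: dist_commute)
    then have "\<rho> z < 0" using U(2) by auto
    moreover have "\<rho> z > 0" using e z \<open>y \<notin> \<Omega>\<close> by (metis min_less_iff_conj)
    ultimately show False by simp
  qed
qed

text \<open>Near \<open>x\<close> the chords of the frontier stay out of a cone around the normal
  direction \<open>v\<close>, as for a Lipschitz graph over the hyperplane orthogonal to
  \<open>v\<close>. The mean value theorem makes each chord orthogonal to the gradient at some point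
  \<open>c\<close> of it, and that gradient is within \<open>n / 2\<close> of
  \<open>grad \<rho> x\<close>, of norm \<open>n\<close>. The constant 3 is the quotient of
  \<open>3 * n / 2\<close> and \<open>n / 2\<close>.\<close>

lemma boundary_transversal:
  fixes \<Omega> :: "(real^'n) set"
  assumes "open \<Omega>" "local_defining_function \<Omega> x U \<rho>"
  shows "\<exists>e>0. \<exists>v. norm v = 1 \<and> (\<forall>y\<in>frontier \<Omega> \<inter> ball x e. \<forall>z\<in>frontier \<Omega> \<inter> ball x e. \<forall>t.
    \<bar>t\<bar> \<le> 3 * norm (z - y - t *\<^sub>R v))"
proof -
  have U: "open U" "x \<in> U" and nz: "grad \<rho> x \<noteq> 0" and d: "\<And>y. y \<in> U \<Longrightarrow> \<rho> differentiable (at y)"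
    and "smooth_on U \<rho>"
    using assms(2) by (auto simp: local_defining_function_def smooth_on_def dest: spec[of _ "Suc 0"])
  then have c: "continuous_on U (\<lambda>y. grad \<rho> y $ i)" for i
    unfolding smooth_on_def by (metis Ck_on.simps)
  have "continuous_on U (grad \<rho>)"
    using continuous_on_vec_lambda[of U "\<lambda>i y. grad \<rho> y $ i"] c by simp
  then have "isCont (grad \<rho>) x" using U by (simp add: continuous_on_eq_continuous_at)
  define n where "n = norm (grad \<rho> x)"
  have n: "n > 0" using nz by (simp add: n_def)
  obtain e1 where e1: "e1 > 0" "\<And>y. dist y x < e1 \<Longrightarrow> dist (grad \<rho> y) (grad \<rho> x) < n / 2"
    using \<open>isCont (grad \<rho>) x\<close> n unfolding continuous_at_eps_delta
    by (metis half_gt_zero)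
  obtain e2 where e2: "e2 > 0" "ball x e2 \<subseteq> U" using U open_contains_ball by blast
  define e where "e = min e1 e2"
  define v where "v = grad \<rho> x /\<^sub>R n"
  have v: "norm v = 1" using n by (simp add: v_def n_def)
  have "\<bar>t\<bar> \<le> 3 * norm (z - y - t *\<^sub>R v)"
    if y: "y \<in> frontier \<Omega> \<inter> ball x e" and z: "z \<in> frontier \<Omega> \<inter> ball x e" for y z t
  proof -
    have sub: "ball x e \<subseteq> U" using e2 by (auto simp: e_def)
    have eq: "\<rho> y = 0" "\<rho> z = 0" using frontier_defining_function_zero[OF assms] y z sub by auto
    define \<gamma> where "\<gamma> t = y + t *\<^sub>R (z - y)" for t
    have \<gamma>: "\<gamma> t \<in> ball x e" if "t \<in> {0..1}" for t
    proof -
      have "\<gamma> t = (1 - t) *\<^sub>R y + t *\<^sub>R z" by (simp add: \<gamma>_def algebra_simps)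
      then show ?thesis using convexD[OF convex_ball, of y x e z "1 - t" t] y z that by simp
    qed
    have "\<exists>t\<in>{0<..<1}. \<rho> (\<gamma> 1) - \<rho> (\<gamma> 0) = grad \<rho> (\<gamma> t) \<bullet> ((1 - 0) *\<^sub>R (z - y))"
    proof (rule mvt_simple)
      fix t :: real assume "0 \<le> t" "t \<le> 1"
      then have "(\<rho> has_derivative (\<lambda>h. grad \<rho> (\<gamma> t) \<bullet> h)) (at (\<gamma> t))"
        using d sub \<gamma>[of t] by (intro has_derivative_grad) auto
      moreover have "(\<gamma> has_derivative (\<lambda>h. h *\<^sub>R (z - y))) (at t within {0..1})"
        unfolding \<gamma>_def by (auto intro!: derivative_eq_intros)
      ultimately show "((\<lambda>t. \<rho> (\<gamma> t)) has_derivative (\<lambda>h. grad \<rho> (\<gamma> t) \<bullet> (h *\<^sub>R (z - y)))) (at t within {0..1})"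
        by (rule has_derivative_compose[rotated])
    qed simp
    then obtain t0 where t0: "t0 \<in> {0<..<1}" "grad \<rho> (\<gamma> t0) \<bullet> (z - y) = 0"
      using eq by (auto simp: \<gamma>_def)
    define c where "c = \<gamma> t0"
    have c0: "grad \<rho> c \<bullet> (z - y) = 0" and "c \<in> ball x e"
      using t0 \<gamma>[of t0] by (auto simp: c_def)
    then have c1: "norm (grad \<rho> c - grad \<rho> x) < n / 2"
      using e1 by (auto simp: e_def dist_commute dist_norm[symmetric])
    have "grad \<rho> x \<bullet> v = n" using n by (simp add: v_def n_def dot_square_norm power2_eq_square)
    moreover have "\<bar>(grad \<rho> c - grad \<rho> x) \<bullet> v\<bar> \<le> n / 2"
      using Cauchy_Schwarz_ineq2[of "grad \<rho> c - grad \<rho> x" v] v c1 by simp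
    ultimately have gv: "grad \<rho> c \<bullet> v \<ge> n / 2"
      unfolding inner_diff_left by linarith
    have gn: "norm (grad \<rho> c) \<le> 3 * n / 2"
      using norm_triangle_sub[of "grad \<rho> c" "grad \<rho> x"] c1 by (simp add: n_def)
    \<comment> \<open>The chord \<open>z - y\<close> is invisible to \<open>grad \<rho> c\<close>,
      so pairing with \<open>z - y - t *\<^sub>R v\<close> isolates the part in
      \<open>t\<close>.\<close>
    have "\<bar>t\<bar> * (n / 2) \<le> \<bar>t\<bar> * (grad \<rho> c \<bullet> v)" using gv by (intro mult_left_mono) auto
    also have "\<dots> = \<bar>grad \<rho> c \<bullet> (z - y - t *\<^sub>R v)\<bar>"
      using c0 gv n by (simp add: inner_diff_right abs_mult)
    also have "\<dots> \<le> norm (grad \<rho> c) * norm (z - y - t *\<^sub>R v)"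
      by (rule Cauchy_Schwarz_ineq2)
    also have "\<dots> \<le> (3 * n / 2) * norm (z - y - t *\<^sub>R v)"
      using gn by (intro mult_right_mono) auto
    finally have "n * \<bar>t\<bar> \<le> n * (3 * norm (z - y - t *\<^sub>R v))" by (simp add: mult_ac)
    then show ?thesis using n by (simp only: mult_le_cancel_left_pos)
  qed
  moreover have "e > 0" using e1 e2 by (simp add: e_def)
  ultimately show ?thesis using v by blast
qed

text \<open>The layer extends to both sides of the frontier, which makes it an open thickening; it
  is cut down to \<open>\<Omega>\<close> only where \<open>w\<close> is integrated over it.\<close>

definition boundary_layer :: "'a::metric_space set \<Rightarrow> real \<Rightarrow> 'a set" where
  "boundary_layer \<Omega> \<delta> = (\<Union>y\<in>frontier \<Omega>. ball y \<delta>)"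

text \<open>The direction \<open>v\<close> of transversality depends on the boundary point, so the
  thickening bound holds patch by patch. Compactness of the frontier leaves finitely many patches,
  whose bounds add up.\<close>

lemma measure_boundary_layer_le:
  fixes \<Omega> :: "(real^'n) set"
  assumes "bounded_smooth_domain \<Omega>"
  shows "\<exists>K>0. \<forall>\<delta>. 0 < \<delta> \<longrightarrow> \<delta> \<le> 1 \<longrightarrow> measure lebesgue (boundary_layer \<Omega> \<delta>) \<le> K * \<delta>"
proof -
  have \<Omega>: "open \<Omega>" "bounded \<Omega>" "\<And>x. x \<in> frontier \<Omega> \<Longrightarrow> \<exists>U \<rho>. local_defining_function \<Omega> x U \<rho>"
    using assms by (auto simp: bounded_smooth_domain_def)
  have cpt: "compact (frontier \<Omega>)" using \<Omega>(2) by (rule compact_frontier_bounded)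
  have "\<exists>e>0. \<exists>K>0. \<forall>\<delta>. 0 < \<delta> \<longrightarrow> \<delta> \<le> 1 \<longrightarrow>
      measure lebesgue (\<Union>y\<in>frontier \<Omega> \<inter> ball x e. ball y \<delta>) \<le> K * \<delta>" if x: "x \<in> frontier \<Omega>" for x
  proof -
    obtain e v where e: "e > 0" "norm v = 1"
      and tr: "\<And>y z t. y \<in> frontier \<Omega> \<inter> ball x e \<Longrightarrow> z \<in> frontier \<Omega> \<inter> ball x e \<Longrightarrow>
        \<bar>t\<bar> \<le> 3 * norm (z - y - t *\<^sub>R v)"
      using boundary_transversal[OF \<Omega>(1)] \<Omega>(3)[OF x] by metis
    have "bounded (frontier \<Omega> \<inter> ball x e)" by (simp add: bounded_Int)
    from measure_thickening_le[OF this, of 3 v] e tr show ?thesis by (intro exI[of _ e]) auto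
  qed
  then obtain e K where e: "\<And>x. x \<in> frontier \<Omega> \<Longrightarrow> e x > 0" "\<And>x. x \<in> frontier \<Omega> \<Longrightarrow> K x > 0"
    and K: "\<And>x \<delta>. x \<in> frontier \<Omega> \<Longrightarrow> 0 < \<delta> \<Longrightarrow> \<delta> \<le> 1 \<Longrightarrow>
      measure lebesgue (\<Union>y\<in>frontier \<Omega> \<inter> ball x (e x). ball y \<delta>) \<le> K x * \<delta>"
    by metis
  obtain F where F: "F \<subseteq> frontier \<Omega>" "finite F" "frontier \<Omega> \<subseteq> (\<Union>x\<in>F. ball x (e x))"
    using compactE_image[OF cpt, of "frontier \<Omega>" "\<lambda>x. ball x (e x)"] e(1)
    by (metis (no_types, lifting) UN_iff centre_in_ball open_ball subsetI)
  \<comment> \<open>The summand 1 makes the constant positive whether or not \<open>F\<close> is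
    empty.\<close>
  have "measure lebesgue (boundary_layer \<Omega> \<delta>) \<le> (sum K F + 1) * \<delta>" if \<delta>: "0 < \<delta>" "\<delta> \<le> 1" for \<delta>
  proof -
    define A where "A x = (\<Union>y\<in>frontier \<Omega> \<inter> ball x (e x). ball y \<delta>)" for x
    have lA: "A x \<in> lmeasurable" for x
      unfolding A_def by (intro lmeasurable_thickening) (simp add: bounded_Int)
    have "boundary_layer \<Omega> \<delta> = (\<Union>x\<in>F. A x)"
      using F(3) unfolding boundary_layer_def A_def by blast
    then have "measure lebesgue (boundary_layer \<Omega> \<delta>) \<le> (\<Sum>x\<in>F. measure lebesgue (A x))"
      using measure_UNION_le[OF F(2), of A lebesgue] lA by (simp add: fmeasurable_def)
    also have "\<dots> \<le> (\<Sum>x\<in>F. K x * \<delta>)"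
      using K \<delta> F(1) by (intro sum_mono) (auto simp: A_def)
    also have "\<dots> \<le> (sum K F + 1) * \<delta>" using \<delta> by (simp add: sum_distrib_right distrib_right)
    finally show ?thesis .
  qed
  moreover have "sum K F + 1 > 0" using e(2) F(1) by (intro add_nonneg_pos sum_nonneg) (auto simp: less_imp_le subset_iff)
  ultimately show ?thesis by blast
qed

text \<open>A ball is connected, so if it met both \<open>\<Omega>\<close> and the complement it
  would meet the frontier, and its centre would lie in the layer.\<close>

lemma ball_subset_domain:
  fixes \<Omega> :: "'a::real_normed_vector set"
  assumes "x \<in> \<Omega>" "x \<notin> boundary_layer \<Omega> \<delta>"
  shows "ball x \<delta> \<subseteq> \<Omega>"
proof (rule ccontr)
  assume n: "\<not> ball x \<delta> \<subseteq> \<Omega>"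
  then have "\<delta> > 0" by (metis ball_eq_empty empty_subsetI linorder_not_less)
  then have "ball x \<delta> \<inter> frontier \<Omega> \<noteq> {}"
    using n centre_in_ball[of x \<delta>] assms(1) \<open>\<delta> > 0\<close> by (intro connected_Int_frontier) blast+
  then show False using assms(2) by (auto simp: boundary_layer_def dist_commute)
qed

section \<open>Second order conditions at a maximum\<close>

text \<open>Schur complements reduce the dimension: removing the rank one part of \<open>a\<close> carried by one
  index leaves a positive definite form in the remaining indices.\<close>

lemma sum_mult_nonpos_of_definite:
  fixes a h :: "'i \<Rightarrow> 'i \<Rightarrow> real"
  assumes "finite I"
    and sym: "\<And>i j. i \<in> I \<Longrightarrow> j \<in> I \<Longrightarrow> a i j = a j i"
    and pos: "\<And>z. \<exists>i\<in>I. z i \<noteq> 0 \<Longrightarrow> (\<Sum>i\<in>I. \<Sum>j\<in>I. a i j * z i * z j) > 0"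
    and nonpos: "\<And>z. (\<Sum>i\<in>I. \<Sum>j\<in>I. h i j * z i * z j) \<le> 0"
  shows "(\<Sum>i\<in>I. \<Sum>j\<in>I. a i j * h i j) \<le> 0"
  using assms
proof (induction I arbitrary: a rule: finite_induct)
  case empty
  then show ?case by simp
next
  case (insert k I)
  note sym = insert.prems(1) and pos = insert.prems(2) and nonpos = insert.prems(3)
  have split: "(\<Sum>i\<in>insert k I. \<Sum>j\<in>insert k I. F i j) =
      F k k + (\<Sum>j\<in>I. F k j) + (\<Sum>i\<in>I. F i k) + (\<Sum>i\<in>I. \<Sum>j\<in>I. F i j)" for F :: "'i \<Rightarrow> 'i \<Rightarrow> real"
    using insert.hyps by (simp add: sum.distrib)
  have restrict: "(\<Sum>i\<in>I. if i = k then (c::real) else F i) = (\<Sum>i\<in>I. F i)" for c F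
    using insert.hyps(2) by (intro sum.cong) auto
  define d where "d = a k k"
  have d: "d > 0"
  proof -
    have "(\<Sum>i\<in>I. a i k * (if i = k then 1 else 0)) = 0" "(\<Sum>j\<in>I. a k j * (if j = k then 1 else 0)) = 0"
      "(\<Sum>i\<in>I. \<Sum>j\<in>I. a i j * (if i = k then 1 else 0) * (if j = k then 1 else 0)) = 0"
      using insert.hyps(2) by (auto intro!: sum.neutral)
    then show ?thesis
      using pos[of "\<lambda>i. if i = k then 1 else 0"] insert.hyps unfolding split d_def by simp
  qed
  define s where "s i j = a i j - a i k * a k j / d" for i j
  have "(\<Sum>i\<in>I. \<Sum>j\<in>I. s i j * h i j) \<le> 0"
  proof (rule insert.IH)
    show "s i j = s j i" if "i \<in> I" "j \<in> I" for i j
      using that sym by (simp add: s_def)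
    show "(\<Sum>i\<in>I. \<Sum>j\<in>I. s i j * z i * z j) > 0" if z: "\<exists>i\<in>I. z i \<noteq> 0" for z
    proof -
      define S where "S = (\<Sum>j\<in>I. a k j * z j)"
      \<comment> \<open>This value of the coordinate \<open>k\<close> minimises the form of
        \<open>a\<close> for given \<open>z\<close>; the minimum is the form of the Schur complement
        \<open>s\<close> at \<open>z\<close>.\<close>
      define y where "y i = (if i = k then - S / d else z i)" for i
      have yI: "y i = z i" if "i \<in> I" for i using that insert.hyps(2) by (auto simp: y_def)
      have "0 < (\<Sum>i\<in>insert k I. \<Sum>j\<in>insert k I. a i j * y i * y j)"
        using z yI by (intro pos) force
      also have "\<dots> = d * (S / d)\<^sup>2 - S / d * (\<Sum>j\<in>I. a k j * z j) - S / d * (\<Sum>i\<in>I. a i k * z i)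
          + (\<Sum>i\<in>I. \<Sum>j\<in>I. a i j * z i * z j)"
      proof -
        have "y k = - S / d" by (simp add: y_def)
        moreover have "(\<Sum>j\<in>I. a k j * y k * y j) = - (S / d * (\<Sum>j\<in>I. a k j * z j))"
          using yI by (simp add: y_def sum_distrib_left sum_negf[symmetric] mult_ac)
        moreover have "(\<Sum>i\<in>I. a i k * y i * y k) = - (S / d * (\<Sum>i\<in>I. a i k * z i))"
          using yI by (simp add: y_def sum_distrib_left sum_negf[symmetric] mult_ac)
        moreover have "(\<Sum>i\<in>I. \<Sum>j\<in>I. a i j * y i * y j) = (\<Sum>i\<in>I. \<Sum>j\<in>I. a i j * z i * z j)"
          using yI by simp
        ultimately show ?thesis unfolding split by (simp add: d_def power2_eq_square)
      qed
      also have "(\<Sum>i\<in>I. a i k * z i) = S"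
        unfolding S_def using sym by (intro sum.cong) auto
      also have "(\<Sum>j\<in>I. a k j * z j) = S" by (simp add: S_def)
      also have "d * (S / d)\<^sup>2 - S / d * S - S / d * S + (\<Sum>i\<in>I. \<Sum>j\<in>I. a i j * z i * z j) =
          (\<Sum>i\<in>I. \<Sum>j\<in>I. a i j * z i * z j) - S * S / d"
        using d by (simp add: power2_eq_square field_simps)
      also have "S * S / d = (\<Sum>i\<in>I. \<Sum>j\<in>I. a i k * a k j / d * z i * z j)"
      proof -
        have "S * S = (\<Sum>i\<in>I. a i k * z i) * (\<Sum>j\<in>I. a k j * z j)"
          using \<open>(\<Sum>i\<in>I. a i k * z i) = S\<close> by (simp add: S_def)
        then show ?thesis by (simp add: sum_product sum_divide_distrib mult_ac)
      qed
      finally show ?thesis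
        by (simp add: s_def left_diff_distrib sum_subtractf)
    qed
    show "(\<Sum>i\<in>I. \<Sum>j\<in>I. h i j * z i * z j) \<le> 0" for z
    proof -
      define y where "y i = (if i = k then 0 else z i)" for i
      have yI: "y i = z i" if "i \<in> I" for i using that insert.hyps(2) by (auto simp: y_def)
      have "y k = 0" by (simp add: y_def)
      then show ?thesis using nonpos[of y] yI unfolding split by simp
    qed
  qed
  \<comment> \<open>The rank one part pairs with \<open>h\<close> to the form of \<open>h\<close> at
    the column \<open>k\<close> of \<open>a\<close>, divided by \<open>d\<close>, hence to something
    nonpositive. The remainder \<open>s\<close> vanishes in row and column \<open>k\<close>, so only
    the sum over \<open>I\<close> is left for the induction hypothesis.\<close>
  moreover have "(\<Sum>i\<in>insert k I. \<Sum>j\<in>insert k I. a i j * h i j) =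
      (\<Sum>i\<in>insert k I. \<Sum>j\<in>insert k I. h i j * a i k * a j k) / d + (\<Sum>i\<in>I. \<Sum>j\<in>I. s i j * h i j)"
  proof -
    have "(\<Sum>i\<in>insert k I. \<Sum>j\<in>insert k I. a i j * h i j) =
       (\<Sum>i\<in>insert k I. \<Sum>j\<in>insert k I. h i j * a i k * a j k / d + s i j * h i j)"
    proof (intro sum.cong refl)
      fix i j assume "i \<in> insert k I" "j \<in> insert k I"
      then have "a k j = a j k" using sym by simp
      then show "a i j * h i j = h i j * a i k * a j k / d + s i j * h i j"
        by (simp add: s_def algebra_simps)
    qed
    moreover have "s k j = 0" "s j k = 0" for j using d by (simp_all add: s_def d_def)
    then have "(\<Sum>i\<in>insert k I. \<Sum>j\<in>insert k I. s i j * h i j) = (\<Sum>i\<in>I. \<Sum>j\<in>I. s i j * h i j)"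
      unfolding split by simp
    ultimately show ?thesis by (simp only: sum.distrib sum_divide_distrib)
  qed
  moreover have "(\<Sum>i\<in>insert k I. \<Sum>j\<in>insert k I. h i j * a i k * a j k) / d \<le> 0"
    using nonpos[of "\<lambda>i. a i k"] d by (simp only: divide_nonpos_pos)
  ultimately show ?case by linarith
qed

text \<open>If \<open>l\<close> were positive, \<open>\<phi>'\<close> would be positive just to the
  right of 0, and the mean value theorem would push \<open>\<phi>\<close> above
  \<open>\<phi> 0\<close>.\<close>

lemma second_derivative_nonpos_at_local_max:
  fixes \<phi> :: "real \<Rightarrow> real"
  assumes "e > 0"
    and d1: "\<And>t. \<bar>t\<bar> < e \<Longrightarrow> (\<phi> has_real_derivative \<phi>' t) (at t)"
    and d2: "(\<phi>' has_real_derivative l) (at 0)"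
    and max: "\<And>t. \<bar>t\<bar> < e \<Longrightarrow> \<phi> t \<le> \<phi> 0"
  shows "\<phi>' 0 = 0" "l \<le> 0"
proof -
  show z: "\<phi>' 0 = 0"
    using DERIV_local_max[OF d1[of 0] \<open>e > 0\<close>] max \<open>e > 0\<close> by simp
  show "l \<le> 0"
  proof (rule ccontr)
    assume "\<not> l \<le> 0"
    then obtain d where d: "d > 0" "\<And>h. h > 0 \<Longrightarrow> h < d \<Longrightarrow> \<phi>' h > 0"
      using DERIV_pos_inc_right[OF d2] z by auto
    define t where "t = min d e / 2"
    have t: "t > 0" "t < d" "t < e" using d \<open>e > 0\<close> by (auto simp: t_def)
    obtain s where "s > 0" "s < t" "\<phi> t - \<phi> 0 = (t - 0) * \<phi>' s"
      using MVT2[of 0 t \<phi> \<phi>'] t d1 by auto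
    then have "\<phi> t > \<phi> 0" using d(2)[of s] t by (metis diff_gt_0_iff_gt diff_zero mult_pos_pos order_less_trans)
    then show False using max[of t] t by simp
  qed
qed

text \<open>Restriction to the lines through \<open>x\<close> reduces both claims to one variable.
  The row \<open>H $ j\<close> is the gradient of the partial derivative \<open>j\<close>, so
  \<open>H $ j $ i\<close> is the derivative of that partial derivative in direction
  \<open>i\<close>. The subtracted square is the barrier; \<open>c = 0\<close> gives an ordinary
  local maximum.\<close>

lemma hessian_at_local_max_minus_square:
  fixes u :: "real^'n \<Rightarrow> real"
  assumes "e > 0"
    and G: "\<And>y. y \<in> ball x e \<Longrightarrow> (u has_derivative (\<lambda>h. G y \<bullet> h)) (at y)"
    and H: "\<And>j. ((\<lambda>y. G y $ j) has_derivative (\<lambda>h. H $ j \<bullet> h)) (at x)"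
    and max: "\<And>y. y \<in> ball x e \<Longrightarrow> u y - c * (norm (y - x0))\<^sup>2 \<le> u x - c * (norm (x - x0))\<^sup>2"
  shows "G x = (2 * c) *\<^sub>R (x - x0)"
    and "(\<Sum>i\<in>UNIV. \<Sum>j\<in>UNIV. H $ j $ i * \<xi> i * \<xi> j) \<le> 2 * c * (\<Sum>i\<in>UNIV. \<xi> i * \<xi> i)"
proof -
  have main: "(G x - (2 * c) *\<^sub>R (x - x0)) \<bullet> z = 0 \<and> (\<Sum>j\<in>UNIV. z $ j * (H $ j \<bullet> z)) - 2 * c * (z \<bullet> z) \<le> 0" for z :: "real^'n"
  proof -
    \<comment> \<open>The added 1 lets \<open>z = 0\<close> pass without a case distinction.\<close>
    define \<epsilon> where "\<epsilon> = e / (norm z + 1)"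
    have \<epsilon>: "\<epsilon> > 0" using \<open>e > 0\<close> by (simp add: \<epsilon>_def add_nonneg_pos)
    have inb: "x + t *\<^sub>R z \<in> ball x e" if "\<bar>t\<bar> < \<epsilon>" for t
    proof -
      have "\<bar>t\<bar> * norm z \<le> \<bar>t\<bar> * (norm z + 1)" by (simp add: mult_left_mono)
      also have "\<dots> < e" using that by (simp add: \<epsilon>_def pos_less_divide_eq add_nonneg_pos)
      finally show ?thesis by (simp add: dist_norm)
    qed
    define \<phi> where "\<phi> t = u (x + t *\<^sub>R z) - c * ((x + t *\<^sub>R z - x0) \<bullet> (x + t *\<^sub>R z - x0))" for t
    define \<phi>' where "\<phi>' t = (\<Sum>j\<in>UNIV. G (x + t *\<^sub>R z) $ j * z $ j) - 2 * c * ((x + t *\<^sub>R z - x0) \<bullet> z)" for t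
    have line: "((\<lambda>t. x + t *\<^sub>R z) has_derivative (\<lambda>h. h *\<^sub>R z)) (at t)" for t
      by (auto intro!: derivative_eq_intros)
    have d1: "(\<phi> has_real_derivative \<phi>' t) (at t)" if "\<bar>t\<bar> < \<epsilon>" for t
    proof -
      have "((\<lambda>t. u (x + t *\<^sub>R z)) has_derivative (\<lambda>h. G (x + t *\<^sub>R z) \<bullet> (h *\<^sub>R z))) (at t)"
        using has_derivative_compose[OF line G[OF inb[OF that]]] .
      moreover have "((\<lambda>t. c * ((x + t *\<^sub>R z - x0) \<bullet> (x + t *\<^sub>R z - x0))) has_derivative
          (\<lambda>h. c * (2 * h * ((x + t *\<^sub>R z - x0) \<bullet> z)))) (at t)"
        by (auto intro!: derivative_eq_intros simp: inner_commute algebra_simps)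
      ultimately have "(\<phi> has_derivative (\<lambda>h. G (x + t *\<^sub>R z) \<bullet> (h *\<^sub>R z) - c * (2 * h * ((x + t *\<^sub>R z - x0) \<bullet> z)))) (at t)"
        unfolding \<phi>_def by (rule has_derivative_diff)
      moreover have "(\<lambda>h. G (x + t *\<^sub>R z) \<bullet> (h *\<^sub>R z) - c * (2 * h * ((x + t *\<^sub>R z - x0) \<bullet> z))) = (*) (\<phi>' t)"
        by (auto simp: \<phi>'_def inner_vec_def algebra_simps sum_distrib_left)
      ultimately show ?thesis by (simp add: has_field_derivative_def)
    qed
    have d2: "(\<phi>' has_real_derivative ((\<Sum>j\<in>UNIV. z $ j * (H $ j \<bullet> z)) - 2 * c * (z \<bullet> z))) (at 0)"
    proof -
      have "((\<lambda>t. G (x + t *\<^sub>R z) $ j) has_derivative (\<lambda>h. H $ j \<bullet> (h *\<^sub>R z))) (at 0)" for j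
        by (rule has_derivative_compose[OF line]) (simp add: H)
      then have "((\<lambda>t. \<Sum>j\<in>UNIV. G (x + t *\<^sub>R z) $ j * z $ j) has_derivative
          (\<lambda>h. \<Sum>j\<in>UNIV. (H $ j \<bullet> (h *\<^sub>R z)) * z $ j)) (at 0)"
        by (intro has_derivative_sum has_derivative_mult_left)
      moreover have "((\<lambda>t. 2 * c * ((x + t *\<^sub>R z - x0) \<bullet> z)) has_derivative (\<lambda>h. 2 * c * h * (z \<bullet> z))) (at 0)"
        by (auto intro!: derivative_eq_intros simp: algebra_simps)
      ultimately have "(\<phi>' has_derivative (\<lambda>h. (\<Sum>j\<in>UNIV. (H $ j \<bullet> (h *\<^sub>R z)) * z $ j) - 2 * c * h * (z \<bullet> z))) (at 0)"
        unfolding \<phi>'_def by (rule has_derivative_diff)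
      moreover have "(\<lambda>h. (\<Sum>j\<in>UNIV. (H $ j \<bullet> (h *\<^sub>R z)) * z $ j) - 2 * c * h * (z \<bullet> z))
         = (*) ((\<Sum>j\<in>UNIV. z $ j * (H $ j \<bullet> z)) - 2 * c * (z \<bullet> z))"
        by (auto simp: sum_distrib_left sum_distrib_right algebra_simps)
      ultimately show ?thesis by (simp add: has_field_derivative_def)
    qed
    have m: "\<phi> t \<le> \<phi> 0" if "\<bar>t\<bar> < \<epsilon>" for t
      using max[OF inb[OF that]] by (simp add: \<phi>_def power2_norm_eq_inner)
    have "\<phi>' 0 = (G x - (2 * c) *\<^sub>R (x - x0)) \<bullet> z"
      by (simp add: \<phi>'_def inner_diff_left) (simp add: inner_vec_def)
    then show ?thesis
      using second_derivative_nonpos_at_local_max[OF \<epsilon> d1 d2 m] by simp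
  qed
  have "(G x - (2 * c) *\<^sub>R (x - x0)) \<bullet> (G x - (2 * c) *\<^sub>R (x - x0)) = 0" using main by blast
  then show "G x = (2 * c) *\<^sub>R (x - x0)" by simp
  have "(\<Sum>j\<in>UNIV. \<xi> j * (\<Sum>i\<in>UNIV. H $ j $ i * \<xi> i)) \<le> 2 * c * (\<Sum>i\<in>UNIV. \<xi> i * \<xi> i)"
    using main[of "\<chi> i. \<xi> i"] by (simp add: inner_vec_def)
  moreover have "(\<Sum>j\<in>UNIV. \<xi> j * (\<Sum>i\<in>UNIV. H $ j $ i * \<xi> i)) = (\<Sum>i\<in>UNIV. \<Sum>j\<in>UNIV. H $ j $ i * \<xi> i * \<xi> j)"
    by (subst sum.swap) (simp add: sum_distrib_left mult_ac)
  ultimately show "(\<Sum>i\<in>UNIV. \<Sum>j\<in>UNIV. H $ j $ i * \<xi> i * \<xi> j) \<le> 2 * c * (\<Sum>i\<in>UNIV. \<xi> i * \<xi> i)"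
    by simp
qed

section \<open>Maximum principle and interior decay\<close>

text \<open>Gradient and Hessian enter as witnesses \<open>G\<close> and \<open>H\<close>, so they
  can be supplied directly for \<open>- u\<close> or \<open>u - k\<close>. The equation is linear
  and homogeneous in \<open>u\<close>, the form shared by \<open>\<Phi> - 1\<close> and
  \<open>\<Psi>\<close>.\<close>

definition nondivergence_solution ::
  "(real^'n) set \<Rightarrow> (real^'n \<Rightarrow> real^'n^'n) \<Rightarrow> (real^'n \<Rightarrow> real^'n) \<Rightarrow> (real^'n \<Rightarrow> real) \<Rightarrow>
   (real^'n \<Rightarrow> real) \<Rightarrow> bool" where
  "nondivergence_solution \<Omega> a \<beta> c u \<longleftrightarrow>
     (\<exists>G H. \<forall>x\<in>\<Omega>. (u has_derivative (\<lambda>h. G x \<bullet> h)) (at x) \<and>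
       (\<forall>j. ((\<lambda>y. G y $ j) has_derivative (\<lambda>h. H x $ j \<bullet> h)) (at x)) \<and>
       (\<Sum>i\<in>UNIV. \<Sum>j\<in>UNIV. a x $ i $ j * H x $ j $ i) + \<beta> x \<bullet> G x = c x * u x)"

definition positive_definite :: "real^'n^'n \<Rightarrow> bool" where
  "positive_definite A \<longleftrightarrow> transpose A = A \<and>
     (\<forall>z. z \<noteq> 0 \<longrightarrow> (\<Sum>i\<in>UNIV. \<Sum>j\<in>UNIV. A $ i $ j * z $ i * z $ j) > 0)"

lemma nondivergence_solution_uminus:
  assumes "nondivergence_solution \<Omega> a \<beta> c u"
  shows "nondivergence_solution \<Omega> a \<beta> c (\<lambda>x. - u x)"
proof -
  obtain G H where *: "\<And>x. x \<in> \<Omega> \<Longrightarrow> (u has_derivative (\<lambda>h. G x \<bullet> h)) (at x)"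
    "\<And>x j. x \<in> \<Omega> \<Longrightarrow> ((\<lambda>y. G y $ j) has_derivative (\<lambda>h. H x $ j \<bullet> h)) (at x)"
    "\<And>x. x \<in> \<Omega> \<Longrightarrow> (\<Sum>i\<in>UNIV. \<Sum>j\<in>UNIV. a x $ i $ j * H x $ j $ i) + \<beta> x \<bullet> G x = c x * u x"
    using assms unfolding nondivergence_solution_def by blast
  show ?thesis
    unfolding nondivergence_solution_def
  proof (intro exI[of _ "\<lambda>x. - G x"] exI[of _ "\<lambda>x. - H x"] ballI conjI allI)
    fix x assume x: "x \<in> \<Omega>"
    show "((\<lambda>x. - u x) has_derivative (\<lambda>h. - G x \<bullet> h)) (at x)"
      using has_derivative_minus[OF *(1)[OF x]] by simp
    show "((\<lambda>y. (- G y) $ j) has_derivative (\<lambda>h. (- H x) $ j \<bullet> h)) (at x)" for j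
      using has_derivative_minus[OF *(2)[OF x, of j]] by simp
    show "(\<Sum>i\<in>UNIV. \<Sum>j\<in>UNIV. a x $ i $ j * (- H x) $ j $ i) + \<beta> x \<bullet> - G x = c x * - u x"
      using *(3)[OF x] by (simp add: sum_negf)
  qed
qed

text \<open>At such a point the gradient is that of the barrier, and the Hessian minus
  \<open>2 * \<alpha>\<close> times the identity has a nonpositive form. Pairing the latter with the
  positive definite \<open>a x\<close> bounds the second order part by
  \<open>2 * \<alpha> * trace (a x)\<close>. The case \<open>\<alpha> = 0\<close> serves the maximum
  principle, a positive \<open>\<alpha>\<close> the interior decay.\<close>

lemma nondivergence_solution_at_local_max:
  assumes "open \<Omega>" "nondivergence_solution \<Omega> a \<beta> c u" "x \<in> \<Omega>" "e > 0"
    and a: "positive_definite (a x)"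
    and max: "\<And>y. y \<in> ball x e \<Longrightarrow> u y - \<alpha> * (norm (y - x0))\<^sup>2 \<le> u x - \<alpha> * (norm (x - x0))\<^sup>2"
  shows "c x * u x \<le> 2 * \<alpha> * (trace (a x) + \<beta> x \<bullet> (x - x0))"
proof -
  obtain G H where *: "\<And>x. x \<in> \<Omega> \<Longrightarrow> (u has_derivative (\<lambda>h. G x \<bullet> h)) (at x)"
    "\<And>x j. x \<in> \<Omega> \<Longrightarrow> ((\<lambda>y. G y $ j) has_derivative (\<lambda>h. H x $ j \<bullet> h)) (at x)"
    "\<And>x. x \<in> \<Omega> \<Longrightarrow> (\<Sum>i\<in>UNIV. \<Sum>j\<in>UNIV. a x $ i $ j * H x $ j $ i) + \<beta> x \<bullet> G x = c x * u x"
    using assms unfolding nondivergence_solution_def by blast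
  obtain e' where e': "e' > 0" "ball x e' \<subseteq> \<Omega>" using assms(1,3) open_contains_ball by blast
  define r where "r = min e e'"
  have r: "r > 0" "\<And>y. y \<in> ball x r \<Longrightarrow> y \<in> ball x e" "\<And>y. y \<in> ball x r \<Longrightarrow> y \<in> \<Omega>"
    using e' assms(4) by (auto simp: r_def)
  have G: "G x = (2 * \<alpha>) *\<^sub>R (x - x0)"
    by (rule hessian_at_local_max_minus_square(1)[OF r(1) *(1)[OF r(3)] *(2)[OF assms(3)] max[OF r(2)]])
  have H: "(\<Sum>i\<in>UNIV. \<Sum>j\<in>UNIV. H x $ j $ i * z i * z j) \<le> 2 * \<alpha> * (\<Sum>i\<in>UNIV. z i * z i)" for z
    by (rule hessian_at_local_max_minus_square(2)[OF r(1) *(1)[OF r(3)] *(2)[OF assms(3)] max[OF r(2)]])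
  have diag: "(\<Sum>i\<in>UNIV. \<Sum>j\<in>UNIV. F i j * (if i = j then 2 * \<alpha> else 0)) = 2 * \<alpha> * (\<Sum>i\<in>UNIV. F i i)"
    for F :: "'a \<Rightarrow> 'a \<Rightarrow> real"
  proof -
    have "(\<Sum>j\<in>UNIV. F i j * (if i = j then 2 * \<alpha> else 0)) = (\<Sum>j\<in>UNIV. if i = j then 2 * \<alpha> * F i j else 0)" for i
      by (intro sum.cong) auto
    then show ?thesis by (simp add: sum_distrib_left)
  qed
  have "(\<Sum>i\<in>UNIV. \<Sum>j\<in>UNIV. a x $ i $ j * (H x $ j $ i - (if i = j then 2 * \<alpha> else 0))) \<le> 0"
  proof (rule sum_mult_nonpos_of_definite)
    show "a x $ i $ j = a x $ j $ i" for i j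
    proof -
      have "a x $ i $ j = transpose (a x) $ j $ i" by (simp add: transpose_def)
      then show ?thesis using a by (simp add: positive_definite_def)
    qed
    show "(\<Sum>i\<in>UNIV. \<Sum>j\<in>UNIV. a x $ i $ j * z i * z j) > 0" if "\<exists>i\<in>UNIV. z i \<noteq> 0" for z
    proof -
      have "(\<chi> i. z i) \<noteq> 0" using that by (auto simp: vec_eq_iff)
      then have "(\<Sum>i\<in>UNIV. \<Sum>j\<in>UNIV. a x $ i $ j * (\<chi> i. z i) $ i * (\<chi> i. z i) $ j) > 0"
        using a unfolding positive_definite_def by blast
      then show ?thesis by simp
    qed
    show "(\<Sum>i\<in>UNIV. \<Sum>j\<in>UNIV. (H x $ j $ i - (if i = j then 2 * \<alpha> else 0)) * z i * z j) \<le> 0" for z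
    proof -
      have "(H x $ j $ i - (if i = j then 2 * \<alpha> else 0)) * z i * z j =
          H x $ j $ i * z i * z j - z i * z j * (if i = j then 2 * \<alpha> else 0)" for i j
        by (simp add: algebra_simps)
      then show ?thesis using H[of z] diag[of "\<lambda>i j. z i * z j"] by (simp only: sum_subtractf)
    qed
  qed simp
  then have "(\<Sum>i\<in>UNIV. \<Sum>j\<in>UNIV. a x $ i $ j * H x $ j $ i) \<le> 2 * \<alpha> * trace (a x)"
    using diag[of "\<lambda>i j. a x $ i $ j"] by (simp only: right_diff_distrib sum_subtractf trace_def)
  then show ?thesis
    using *(3)[OF assms(3)] G by (simp add: distrib_left inner_scaleR_right)
qed

section \<open>Boundary conditions and comparison\<close>

text \<open>Along the normal line \<open>\<rho>\<close> vanishes at \<open>t = 0\<close> with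
  derivative \<open>norm (grad \<rho> x) > 0\<close>, hence is negative for small negative
  \<open>t\<close>. This lets the one-sided normal derivative be compared with values of the
  solution inside the domain.\<close>

lemma inward_normal_eventually_in_domain:
  assumes "open \<Omega>" "x \<in> frontier \<Omega>" "unit_outward_normal \<Omega> x v"
  shows "\<forall>\<^sub>F t in at_left 0. x + t *\<^sub>R v \<in> \<Omega>"
proof -
  obtain U \<rho> where \<rho>: "local_defining_function \<Omega> x U \<rho>" and v: "v = grad \<rho> x /\<^sub>R norm (grad \<rho> x)"
    using assms(3) unfolding unit_outward_normal_def by blast
  have U: "open U" "x \<in> U" "\<Omega> \<inter> U = {y\<in>U. \<rho> y < 0}" and nz: "grad \<rho> x \<noteq> 0"
    and d: "\<rho> differentiable (at x)"
    using \<rho> by (auto simp: local_defining_function_def smooth_on_def dest: spec[of _ "Suc 0"])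
  have "\<rho> x = 0" using frontier_defining_function_zero[OF assms(1) \<rho> assms(2)] U by simp
  have line: "((\<lambda>t. x + t *\<^sub>R v) has_derivative (\<lambda>h. h *\<^sub>R v)) (at 0)"
    by (auto intro!: derivative_eq_intros)
  have "((\<lambda>t. \<rho> (x + t *\<^sub>R v)) has_derivative (\<lambda>h. grad \<rho> x \<bullet> (h *\<^sub>R v))) (at 0)"
    by (rule has_derivative_compose[OF line]) (simp add: has_derivative_grad[OF d])
  moreover have "(\<lambda>h. grad \<rho> x \<bullet> (h *\<^sub>R v)) = (*) (norm (grad \<rho> x))"
    using nz by (auto simp: v dot_square_norm power2_eq_square)
  ultimately have "((\<lambda>t. \<rho> (x + t *\<^sub>R v)) has_real_derivative norm (grad \<rho> x)) (at 0)"
    by (simp add: has_field_derivative_def)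
  from DERIV_pos_inc_left[OF this] nz \<open>\<rho> x = 0\<close>
  obtain e where e: "e > 0" "\<And>h. h > 0 \<Longrightarrow> h < e \<Longrightarrow> \<rho> (x - h *\<^sub>R v) < 0" by auto
  have "\<forall>\<^sub>F t in at_left 0. \<rho> (x + t *\<^sub>R v) < 0"
  proof -
    have "\<rho> (x + t *\<^sub>R v) < 0" if "- e < t" "t < 0" for t
      using e(2)[of "- t"] that by simp
    then show ?thesis
      using e(1) by (subst eventually_at_left[of "- e"]) (auto intro: exI[of _ "- e"])
  qed
  moreover have "((\<lambda>t. x + t *\<^sub>R v) \<longlongrightarrow> x + 0 *\<^sub>R v) (at_left 0)"
    by (intro tendsto_intros)
  then have "\<forall>\<^sub>F t in at_left 0. x + t *\<^sub>R v \<in> U"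
    using U by (auto dest: topological_tendstoD)
  ultimately show ?thesis
    by eventually_elim (use U(3) in blast)
qed

text \<open>The boundary clause of \<open>classical_solution\<close>, isolated so that sign changes
  and shifts by a constant act on solution and datum together.\<close>

definition robin_condition ::
  "(real^'n) set \<Rightarrow> (real^'n \<Rightarrow> real^'n) \<Rightarrow> (real^'n \<Rightarrow> real) \<Rightarrow> (real^'n \<Rightarrow> real) \<Rightarrow> (real^'n \<Rightarrow> real) \<Rightarrow> bool" where
  "robin_condition \<Omega> \<nu> b g u \<longleftrightarrow> (\<forall>x\<in>frontier \<Omega>.
        if b x = 0 then u x = g x
        else \<exists>d. has_normal_derivative u x (\<nu> x) d \<and> u x + b x * d = g x)"

lemma robin_condition_uminus:
  assumes "robin_condition \<Omega> \<nu> b g u"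
  shows "robin_condition \<Omega> \<nu> b (\<lambda>x. - g x) (\<lambda>x. - u x)"
  unfolding robin_condition_def
proof
  fix x assume "x \<in> frontier \<Omega>"
  then have *: "if b x = 0 then u x = g x else \<exists>d. has_normal_derivative u x (\<nu> x) d \<and> u x + b x * d = g x"
    using assms by (simp add: robin_condition_def)
  show "if b x = 0 then - u x = - g x else \<exists>d. has_normal_derivative (\<lambda>x. - u x) x (\<nu> x) d \<and> - u x + b x * d = - g x"
  proof (cases "b x = 0")
    case False
    then obtain d where d: "has_normal_derivative u x (\<nu> x) d" "u x + b x * d = g x" using * by auto
    have "has_normal_derivative (\<lambda>x. - u x) x (\<nu> x) (- d)"
      using d(1) unfolding has_normal_derivative_def by (rule DERIV_minus)
    with d(2) False show ?thesis by auto
  qed (use * in auto)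
qed

text \<open>At an interior maximum the second order condition gives
  \<open>c y * u y \<le> 0\<close>, so \<open>u y \<le> 0 \<le> M\<close>. At a boundary maximum
  with \<open>b y > 0\<close> the derivative \<open>d\<close> along the outward normal, taken from
  inside, is nonnegative, and \<open>u y = g y - b y * d \<le> M\<close>; for \<open>b y = 0\<close>
  the datum bounds \<open>u y\<close> directly.\<close>

lemma maximum_principle:
  assumes "open \<Omega>" "bounded \<Omega>" "\<forall>x\<in>frontier \<Omega>. unit_outward_normal \<Omega> x (\<nu> x)"
    and u: "continuous_on (closure \<Omega>) u" "nondivergence_solution \<Omega> a \<beta> c u" "robin_condition \<Omega> \<nu> b g u"
    and a: "\<And>x. x \<in> \<Omega> \<Longrightarrow> positive_definite (a x)" and c: "\<And>x. x \<in> \<Omega> \<Longrightarrow> c x > 0"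
    and b: "\<And>x. x \<in> frontier \<Omega> \<Longrightarrow> b x \<ge> 0" and g: "\<And>x. x \<in> frontier \<Omega> \<Longrightarrow> g x \<le> M"
    and "M \<ge> 0" "x \<in> closure \<Omega>"
  shows "u x \<le> M"
proof -
  have "compact (closure \<Omega>)" using assms(2) by simp
  then obtain y where y: "y \<in> closure \<Omega>" "\<And>z. z \<in> closure \<Omega> \<Longrightarrow> u z \<le> u y"
    using continuous_attains_sup[OF _ _ u(1)] \<open>x \<in> closure \<Omega>\<close> by (metis empty_iff)
  have "u y \<le> M"
  proof (cases "y \<in> \<Omega>")
    case True
    then obtain e where e: "e > 0" "ball y e \<subseteq> \<Omega>" using assms(1) open_contains_ball by blast
    have "c y * u y \<le> 2 * 0 * (trace (a y) + \<beta> y \<bullet> (y - y))"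
    proof (rule nondivergence_solution_at_local_max[OF assms(1) u(2) True e(1) a[OF True]])
      fix z assume "z \<in> ball y e"
      then have "z \<in> closure \<Omega>" using e(2) closure_subset by blast
      then show "u z - 0 * (norm (z - y))\<^sup>2 \<le> u y - 0 * (norm (y - y))\<^sup>2" using y(2) by simp
    qed
    then have "u y \<le> 0" using c[OF True] by (simp add: mult_le_0_iff)
    then show ?thesis using \<open>M \<ge> 0\<close> by simp
  next
    case False
    then have fr: "y \<in> frontier \<Omega>" using y(1) assms(1) by (simp add: frontier_def interior_open)
    show ?thesis
    proof (cases "b y = 0")
      case True
      then show ?thesis using u(3) fr g by (simp add: robin_condition_def)
    next
      case False
      then obtain d where d: "has_normal_derivative u y (\<nu> y) d" "u y + b y * d = g y"
        using u(3) fr unfolding robin_condition_def by metis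
      have "((\<lambda>t. (u (y + t *\<^sub>R \<nu> y) - u y) / t) \<longlongrightarrow> d) (at_left 0)"
        using d(1) by (simp add: has_normal_derivative_def has_field_derivative_iff)
      moreover have neg: "\<forall>\<^sub>F t in at_left 0. t < (0::real)"
        by (simp add: eventually_at_filter)
      \<comment> \<open>Numerator and denominator are both nonpositive: \<open>y\<close> is a
        maximum point and \<open>t\<close> is negative.\<close>
      have "\<forall>\<^sub>F t in at_left 0. (u (y + t *\<^sub>R \<nu> y) - u y) / t \<ge> 0"
        using inward_normal_eventually_in_domain[OF assms(1) fr assms(3)[rule_format, OF fr]] neg
      proof eventually_elim
        case (elim t)
        then have "u (y + t *\<^sub>R \<nu> y) \<le> u y" using y(2) closure_subset by blast
        then show ?case using elim(2) by (simp add: divide_nonpos_neg)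
      qed
      ultimately have "d \<ge> 0"
        by (intro tendsto_lowerbound) auto
      then have "b y * d \<ge> 0" using b[OF fr] by simp
      then show ?thesis using d(2) g[OF fr] by linarith
    qed
  qed
  then show ?thesis using y(2)[OF assms(12)] by linarith
qed

text \<open>Maximise \<open>u\<close> minus a barrier that vanishes at the centre and reaches
  \<open>M\<close> on the sphere. A maximum on the sphere forces \<open>u x \<le> 0\<close>; at an
  interior one the equation bounds \<open>u\<close> by the barrier coefficient divided by
  \<open>c0\<close>. The factor 4 is 2 from differentiating the square times the two bounds
  \<open>K\<close> for trace and drift, where \<open>r \<le> 1\<close> controls the drift.\<close>

lemma interior_decay:
  assumes "open \<Omega>" and u: "continuous_on (closure \<Omega>) u" "nondivergence_solution \<Omega> a \<beta> c u"
    and a: "\<And>x. x \<in> \<Omega> \<Longrightarrow> positive_definite (a x)"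
    and bounds: "\<And>x. x \<in> \<Omega> \<Longrightarrow> trace (a x) \<le> K" "\<And>x. x \<in> \<Omega> \<Longrightarrow> norm (\<beta> x) \<le> K"
    and c: "c0 > 0" "\<And>x. x \<in> \<Omega> \<Longrightarrow> c x \<ge> c0"
    and M: "M \<ge> 0" "\<And>x. x \<in> closure \<Omega> \<Longrightarrow> u x \<le> M"
    and r: "0 < r" "r \<le> 1" "ball x r \<subseteq> \<Omega>"
  shows "u x \<le> 4 * M * K / (c0 * r\<^sup>2)"
proof -
  have "x \<in> \<Omega>" using r by auto
  then have "K \<ge> 0" using bounds(2) norm_ge_zero order_trans by blast
  have cb: "cball x r \<subseteq> closure \<Omega>" using closure_mono[OF r(3)] r(1) by simp
  \<comment> \<open>The least coefficient for which the barrier offsets the bound \<open>M\<close>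
    on the whole sphere of radius \<open>r\<close>.\<close>
  define \<alpha> where "\<alpha> = M / r\<^sup>2"
  have \<alpha>: "\<alpha> \<ge> 0" using M r by (simp add: \<alpha>_def)
  have "continuous_on (cball x r) (\<lambda>y. u y - \<alpha> * (norm (y - x))\<^sup>2)"
    using continuous_on_subset[OF u(1) cb] by (intro continuous_intros)
  then have "\<exists>y\<in>cball x r. \<forall>z\<in>cball x r. u z - \<alpha> * (norm (z - x))\<^sup>2 \<le> u y - \<alpha> * (norm (y - x))\<^sup>2"
    using r(1) by (intro continuous_attains_sup) auto
  then obtain y where y: "y \<in> cball x r"
    "\<And>z. z \<in> cball x r \<Longrightarrow> u z - \<alpha> * (norm (z - x))\<^sup>2 \<le> u y - \<alpha> * (norm (y - x))\<^sup>2"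
    by blast
  have le: "u x \<le> u y - \<alpha> * (norm (y - x))\<^sup>2" using y(2)[of x] r by simp
  show ?thesis
  proof (cases "y \<in> ball x r")
    case True
    then have "y \<in> \<Omega>" using r by blast
    obtain e where e: "e > 0" "ball y e \<subseteq> ball x r"
      using True open_contains_ball[of "ball x r"] open_ball by blast
    have "c y * u y \<le> 2 * \<alpha> * (trace (a y) + \<beta> y \<bullet> (y - x))"
    proof (rule nondivergence_solution_at_local_max[OF assms(1) u(2) \<open>y \<in> \<Omega>\<close> e(1) a[OF \<open>y \<in> \<Omega>\<close>]])
      fix z assume "z \<in> ball y e"
      then have "z \<in> cball x r" using e(2) by auto
      then show "u z - \<alpha> * (norm (z - x))\<^sup>2 \<le> u y - \<alpha> * (norm (y - x))\<^sup>2" by (rule y(2))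
    qed
    also have "\<dots> \<le> 2 * \<alpha> * (K + K)"
    proof -
      have "norm (y - x) \<le> 1" using True r by (simp add: dist_norm norm_minus_commute)
      have "\<beta> y \<bullet> (y - x) \<le> norm (\<beta> y) * norm (y - x)" by (rule norm_cauchy_schwarz)
      also have "\<dots> \<le> K * 1"
        using bounds(2)[OF \<open>y \<in> \<Omega>\<close>] \<open>norm (y - x) \<le> 1\<close> \<open>K \<ge> 0\<close> by (intro mult_mono) auto
      finally show ?thesis using bounds(1)[OF \<open>y \<in> \<Omega>\<close>] \<alpha> by (intro mult_left_mono) auto
    qed
    finally have *: "c y * u y \<le> 4 * \<alpha> * K" by simp
    \<comment> \<open>Replacing \<open>c y\<close> by the smaller \<open>c0\<close> is monotone only
      for \<open>u y \<ge> 0\<close>; the other case is trivial.\<close>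
    have "c0 * u y \<le> 4 * \<alpha> * K"
    proof (cases "u y \<ge> 0")
      case True
      then have "c0 * u y \<le> c y * u y" using c(2)[OF \<open>y \<in> \<Omega>\<close>] by (rule mult_right_mono[rotated])
      then show ?thesis using * by linarith
    next
      case False
      then have "c0 * u y \<le> 0" using c(1) by (simp add: mult_le_0_iff)
      moreover have "4 * \<alpha> * K \<ge> 0" using \<alpha> \<open>K \<ge> 0\<close> by simp
      ultimately show ?thesis by linarith
    qed
    then have "u y \<le> 4 * \<alpha> * K / c0" using c(1) by (simp add: field_simps)
    moreover have "\<alpha> * (norm (y - x))\<^sup>2 \<ge> 0" using \<alpha> by simp
    ultimately have "u x \<le> 4 * \<alpha> * K / c0" using le by linarith
    then show ?thesis by (simp add: \<alpha>_def mult_ac)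
  next
    case False
    then have "norm (y - x) = r" using y(1) by (simp add: dist_norm norm_minus_commute)
    then have "u x \<le> 0" using le M(2)[of y] y(1) cb r by (auto simp: \<alpha>_def)
    moreover have "4 * M * K / (c0 * r\<^sup>2) \<ge> 0" using M(1) \<open>K \<ge> 0\<close> c(1) by simp
    ultimately show ?thesis by linarith
  qed
qed

section \<open>Reduction to nondivergence form\<close>

definition column_divergence :: "(real^'n \<Rightarrow> real^'n^'n) \<Rightarrow> real^'n \<Rightarrow> real^'n" where
  "column_divergence D x = (\<chi> j. \<Sum>i\<in>UNIV. grad (\<lambda>y. D y $ i $ j) x $ i)"

lemma has_derivative_vec_lambda:
  fixes f :: "'a::real_normed_vector \<Rightarrow> 'n::finite \<Rightarrow> real"
  assumes "\<And>i. ((\<lambda>x. f x i) has_derivative (\<lambda>h. f' h i)) F"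
  shows "((\<lambda>x. \<chi> i. f x i) has_derivative (\<lambda>h. \<chi> i. f' h i)) F"
proof -
  have "((\<lambda>x. \<Sum>i\<in>UNIV. f x i *\<^sub>R (axis i 1 :: real^'n)) has_derivative
      (\<lambda>h. \<Sum>i\<in>UNIV. f' h i *\<^sub>R axis i 1)) F"
    by (intro has_derivative_sum has_derivative_scaleR_left assms)
  moreover have "(\<Sum>i\<in>UNIV. c i *\<^sub>R axis i 1) = (\<chi> i. c i)" for c :: "'n \<Rightarrow> real"
    using basis_expansion[of "\<chi> i. c i"] by (simp add: scalar_mult_eq_scaleR)
  ultimately show ?thesis by simp
qed

text \<open>The product rule for the components of the flux: derivatives falling on \<open>D\<close>
  form the drift \<open>column_divergence D\<close>. The indices of the second derivatives are
  ordered as in \<open>nondivergence_solution\<close>.\<close>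

lemma divergence_matrix_grad:
  fixes u :: "real^'n \<Rightarrow> real" and D :: "real^'n \<Rightarrow> real^'n^'n"
  assumes D: "\<And>i j. (\<lambda>y. D y $ i $ j) differentiable (at x)"
    and u: "\<And>j. (\<lambda>y. grad u y $ j) differentiable (at x)"
  shows "divergence (\<lambda>y. D y *v grad u y) x =
    (\<Sum>i\<in>UNIV. \<Sum>j\<in>UNIV. D x $ i $ j * grad (\<lambda>y. grad u y $ j) x $ i) + column_divergence D x \<bullet> grad u x"
proof -
  \<comment> \<open>Row \<open>i\<close> is the gradient of the component \<open>i\<close> of the
    flux. Once the derivative is multiplication by this matrix, uniqueness of derivatives identifies
    \<open>jacobian\<close>.\<close>
  let ?A = "\<chi> i. \<Sum>j\<in>UNIV. D x $ i $ j *\<^sub>R grad (\<lambda>y. grad u y $ j) x + grad u x $ j *\<^sub>R grad (\<lambda>y. D y $ i $ j) x"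
  have "((\<lambda>y. D y *v grad u y) has_derivative (\<lambda>h. \<chi> i. \<Sum>j\<in>UNIV.
      D x $ i $ j * (grad (\<lambda>y. grad u y $ j) x \<bullet> h) + (grad (\<lambda>y. D y $ i $ j) x \<bullet> h) * grad u x $ j)) (at x)"
    unfolding matrix_vector_mult_def
    by (intro has_derivative_vec_lambda has_derivative_sum has_derivative_mult has_derivative_grad D u)
  moreover have "?A *v h = (\<chi> i. \<Sum>j\<in>UNIV. D x $ i $ j * (grad (\<lambda>y. grad u y $ j) x \<bullet> h) +
      (grad (\<lambda>y. D y $ i $ j) x \<bullet> h) * grad u x $ j)" for h
    unfolding vec_eq_iff matrix_vector_mul_component
    by (simp add: inner_sum_left inner_add_left) (simp add: mult.commute)
  ultimately have der: "((\<lambda>y. D y *v grad u y) has_derivative (*v) ?A) (at x)"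
    by presburger
  have "jacobian (\<lambda>y. D y *v grad u y) (at x) = ?A"
    unfolding jacobian_def frechet_derivative_at[OF der, symmetric] by (rule matrix_of_matrix_vector_mul)
  then have "divergence (\<lambda>y. D y *v grad u y) x = (\<Sum>i\<in>UNIV. \<Sum>j\<in>UNIV.
      D x $ i $ j * grad (\<lambda>y. grad u y $ j) x $ i + grad u x $ j * grad (\<lambda>y. D y $ i $ j) x $ i)"
    by (simp add: divergence_def trace_def sum_component)
  also have "\<dots> = (\<Sum>i\<in>UNIV. \<Sum>j\<in>UNIV. D x $ i $ j * grad (\<lambda>y. grad u y $ j) x $ i) +
      (\<Sum>j\<in>UNIV. \<Sum>i\<in>UNIV. grad u x $ j * grad (\<lambda>y. D y $ i $ j) x $ i)"
    by (subst (2) sum.swap) (simp add: sum.distrib)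
  also have "(\<Sum>j\<in>UNIV. \<Sum>i\<in>UNIV. grad u x $ j * grad (\<lambda>y. D y $ i $ j) x $ i) = column_divergence D x \<bullet> grad u x"
    by (simp add: column_divergence_def inner_vec_def sum_distrib_left mult.commute)
  finally show ?thesis .
qed

text \<open>Subtracting \<open>k\<close> makes the equation homogeneous and moves the constant into
  the datum: \<open>k = 1\<close> treats \<open>\<Phi>\<close> with new datum -1, and
  \<open>k = 0\<close> treats \<open>\<Psi>\<close>.\<close>

lemma classical_solution_nondivergence:
  fixes D :: "real^'n \<Rightarrow> real^'n^'n"
  assumes "classical_solution \<Omega> \<nu> D (\<lambda>x s. c x * (s - k)) b g u"
    and D: "\<forall>i j. C1_closure \<Omega> (\<lambda>x. D x $ i $ j)"
  shows "nondivergence_solution \<Omega> D (column_divergence D) c (\<lambda>x. u x - k)"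
    and "continuous_on (closure \<Omega>) (\<lambda>x. u x - k)"
    and "robin_condition \<Omega> \<nu> b (\<lambda>x. g x - k) (\<lambda>x. u x - k)"
proof -
  have u: "\<And>x. x \<in> \<Omega> \<Longrightarrow> u differentiable (at x)"
    "\<And>x j. x \<in> \<Omega> \<Longrightarrow> (\<lambda>y. grad u y $ j) differentiable (at x)"
    and eq: "\<And>x. x \<in> \<Omega> \<Longrightarrow> - divergence (\<lambda>y. D y *v grad u y) x + c x * (u x - k) = 0"
    and bc: "\<And>x. x \<in> frontier \<Omega> \<Longrightarrow> (if b x = 0 then u x = g x
        else \<exists>d. has_normal_derivative u x (\<nu> x) d \<and> u x + b x * d = g x)"
    and cont: "continuous_on (closure \<Omega>) u"
    using assms(1) by (simp_all add: classical_solution_def numeral_2_eq_2)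
  have dD: "\<And>x i j. x \<in> \<Omega> \<Longrightarrow> (\<lambda>y. D y $ i $ j) differentiable (at x)"
    using D by (simp add: C1_closure_def)
  show "nondivergence_solution \<Omega> D (column_divergence D) c (\<lambda>x. u x - k)"
    unfolding nondivergence_solution_def
  proof (intro exI[of _ "grad u"] exI[of _ "\<lambda>x. \<chi> j. grad (\<lambda>y. grad u y $ j) x"] ballI conjI allI)
    fix x assume x: "x \<in> \<Omega>"
    show "((\<lambda>x. u x - k) has_derivative (\<lambda>h. grad u x \<bullet> h)) (at x)"
      using has_derivative_diff[OF has_derivative_grad[OF u(1)[OF x]] has_derivative_const[of k]] by simp
    show "((\<lambda>y. grad u y $ j) has_derivative (\<lambda>h. (\<chi> j. grad (\<lambda>y. grad u y $ j) x) $ j \<bullet> h)) (at x)" for j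
      using has_derivative_grad[OF u(2)[OF x, of j]] by simp
    show "(\<Sum>i\<in>UNIV. \<Sum>j\<in>UNIV. D x $ i $ j * (\<chi> j. grad (\<lambda>y. grad u y $ j) x) $ j $ i) +
        column_divergence D x \<bullet> grad u x = c x * (u x - k)"
      using eq[OF x] divergence_matrix_grad[OF dD[OF x] u(2)[OF x]] by simp
  qed
  show "continuous_on (closure \<Omega>) (\<lambda>x. u x - k)" using cont by (intro continuous_intros)
  show "robin_condition \<Omega> \<nu> b (\<lambda>x. g x - k) (\<lambda>x. u x - k)"
    unfolding robin_condition_def
  proof
    fix x assume x: "x \<in> frontier \<Omega>"
    show "if b x = 0 then u x - k = g x - k
      else \<exists>d. has_normal_derivative (\<lambda>x. u x - k) x (\<nu> x) d \<and> u x - k + b x * d = g x - k"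
    proof (cases "b x = 0")
      case False
      then obtain d where d: "has_normal_derivative u x (\<nu> x) d" "u x + b x * d = g x"
        using bc[OF x] by metis
      have "has_normal_derivative (\<lambda>x. u x - k) x (\<nu> x) (d - 0)"
        using d(1) unfolding has_normal_derivative_def by (rule DERIV_diff) simp
      with d(2) False show ?thesis by auto
    qed (use bc[OF x] in auto)
  qed
qed

text \<open>On \<open>\<Omega>\<close> the gradients of the coefficients agree with continuous
  functions on the compact closure; this is where regularity of \<open>D\<close> up to the boundary
  enters.\<close>

lemma column_divergence_bounded:
  fixes D :: "real^'n \<Rightarrow> real^'n^'n"
  assumes "bounded \<Omega>" and D: "\<forall>i j. C1_closure \<Omega> (\<lambda>x. D x $ i $ j)"
  shows "\<exists>K. \<forall>x\<in>\<Omega>. norm (column_divergence D x) \<le> K"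
proof -
  have cpt: "compact (closure \<Omega>)" using assms(1) by simp
  have "\<exists>K. \<forall>x\<in>\<Omega>. norm (grad (\<lambda>y. D y $ i $ j) x) \<le> K" for i j
  proof -
    obtain G where G: "continuous_on (closure \<Omega>) G" "\<And>x. x \<in> \<Omega> \<Longrightarrow> G x = grad (\<lambda>x. D x $ i $ j) x"
      using D unfolding C1_closure_def by metis
    obtain K where "\<And>x. x \<in> closure \<Omega> \<Longrightarrow> norm (G x) \<le> K"
      using compact_imp_bounded[OF compact_continuous_image[OF G(1) cpt]] unfolding bounded_iff by blast
    then show ?thesis using G(2) closure_subset by (metis subsetD)
  qed
  then obtain K where K: "\<And>i j x. x \<in> \<Omega> \<Longrightarrow> norm (grad (\<lambda>y. D y $ i $ j) x) \<le> K i j" by metis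
  have "norm (column_divergence D x) \<le> (\<Sum>j\<in>UNIV. \<Sum>i\<in>UNIV. K i j)" if x: "x \<in> \<Omega>" for x
  proof -
    have "norm (column_divergence D x) \<le> (\<Sum>j\<in>UNIV. \<bar>column_divergence D x $ j\<bar>)"
      by (rule norm_le_l1_cart)
    also have "\<dots> \<le> (\<Sum>j\<in>UNIV. \<Sum>i\<in>UNIV. K i j)"
    proof (rule sum_mono)
      fix j
      have "\<bar>column_divergence D x $ j\<bar> \<le> (\<Sum>i\<in>UNIV. \<bar>grad (\<lambda>y. D y $ i $ j) x $ i\<bar>)"
        unfolding column_divergence_def by simp
      also have "\<dots> \<le> (\<Sum>i\<in>UNIV. K i j)"
        using K[OF x] component_le_norm_cart order_trans by (intro sum_mono) blast
      finally show "\<bar>column_divergence D x $ j\<bar> \<le> (\<Sum>i\<in>UNIV. K i j)" .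
    qed
    finally show ?thesis .
  qed
  then show ?thesis by blast
qed

lemma trace_bounded:
  fixes D :: "real^'n \<Rightarrow> real^'n^'n"
  assumes "bounded \<Omega>" and D: "\<forall>i j. C1_closure \<Omega> (\<lambda>x. D x $ i $ j)"
  shows "\<exists>K. \<forall>x\<in>\<Omega>. trace (D x) \<le> K"
proof -
  have cpt: "compact (closure \<Omega>)" using assms(1) by simp
  have "continuous_on (closure \<Omega>) (\<lambda>x. trace (D x))"
    unfolding trace_def using D by (intro continuous_on_sum) (auto simp: C1_closure_def)
  then obtain K where "\<And>x. x \<in> closure \<Omega> \<Longrightarrow> norm (trace (D x)) \<le> K"
    using compact_imp_bounded[OF compact_continuous_image[OF _ cpt], of "\<lambda>x. trace (D x)"]
    unfolding bounded_iff by auto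
  then have "\<forall>x\<in>\<Omega>. trace (D x) \<le> K" using closure_subset[of \<Omega>] by (auto simp: abs_le_iff)
  then show ?thesis by blast
qed

section \<open>Hoelder's inequality on subsets\<close>

lemma indicator_integral_lebesgue_on:
  fixes E :: "'a::euclidean_space set"
  assumes \<Omega>: "\<Omega> \<in> lmeasurable" and E: "E \<in> sets lebesgue" "E \<subseteq> \<Omega>"
  shows "E \<in> sets (lebesgue_on \<Omega>)" "integrable (lebesgue_on \<Omega>) (indicat_real E)"
    "(LINT x|lebesgue_on \<Omega>. indicat_real E x) = measure lebesgue E"
proof -
  have \<Omega>': "\<Omega> \<in> sets lebesgue" using \<Omega> by (rule fmeasurableD)
  have "E \<in> lmeasurable" by (rule fmeasurableI2[OF \<Omega> E(2,1)])
  then have fin: "emeasure lebesgue E < \<infinity>" by (simp only: fmeasurable_def) auto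
  show EM: "E \<in> sets (lebesgue_on \<Omega>)" using E \<Omega>' by (simp add: sets_restrict_space_iff)
  have "emeasure (lebesgue_on \<Omega>) E = emeasure lebesgue E"
    using E(2) \<Omega>' by (intro emeasure_restrict_space) auto
  then show "integrable (lebesgue_on \<Omega>) (indicat_real E)"
    using fin EM by (intro integrable_real_indicator) (simp_all only:)
  have "measure (lebesgue_on \<Omega>) E = measure lebesgue E"
    using E(2) \<Omega>' by (intro measure_restrict_space) auto
  then show "(LINT x|lebesgue_on \<Omega>. indicat_real E x) = measure lebesgue E"
    using E(2) by (simp add: Int_absorb2)
qed

text \<open>Young's inequality for \<open>\<bar>w x\<bar> / s\<close> and
  \<open>indicat_real E x / t\<close>, with \<open>s powr p = B\<close> and
  \<open>t powr q = m\<close>, integrates to at most \<open>1 / p + 1 / q = 1\<close>. Using only a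
  positive upper bound \<open>m\<close> for the measure of \<open>E\<close> admits null
  sets.\<close>

lemma integral_abs_le_powr:
  fixes w :: "'a::euclidean_space \<Rightarrow> real"
  assumes p: "p > 1" and w: "integrable (lebesgue_on \<Omega>) w"
    and wp: "integrable (lebesgue_on \<Omega>) (\<lambda>x. \<bar>w x\<bar> powr p)"
    and \<Omega>: "\<Omega> \<in> lmeasurable" and E: "E \<in> sets lebesgue" "E \<subseteq> \<Omega>" and m: "measure lebesgue E \<le> m" "m > 0"
  shows "(LINT x|lebesgue_on \<Omega>. indicat_real E x * \<bar>w x\<bar>) \<le>
    (LINT x|lebesgue_on \<Omega>. \<bar>w x\<bar> powr p) powr (1 / p) * m powr (1 - 1 / p)"
proof -
  let ?M = "lebesgue_on \<Omega>"
  define A where "A = (LINT x|?M. \<bar>w x\<bar> powr p)"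
  define q where "q = p / (p - 1)"
  have q: "q > 1" "1 / p + 1 / q = 1" "1 - 1 / p = 1 / q" using p by (auto simp: q_def field_simps)
  have A: "A \<ge> 0" by (auto simp: A_def intro!: integral_nonneg)
  note EM = indicator_integral_lebesgue_on(1)[OF \<Omega> E] and iE = indicator_integral_lebesgue_on(2)[OF \<Omega> E]
    and mE = indicator_integral_lebesgue_on(3)[OF \<Omega> E]
  have iw: "integrable ?M (\<lambda>x. indicat_real E x * \<bar>w x\<bar>)"
    using integrable_mult_indicator[OF EM, of "\<lambda>x. \<bar>w x\<bar>"] w by simp
  \<comment> \<open>The normalisation divides by \<open>B\<close>, so a positive
    \<open>B \<ge> A\<close> replaces the integral \<open>A\<close>, which might be 0; afterwards
    \<open>B\<close> decreases to \<open>A\<close>.\<close>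
  have est: "(LINT x|?M. indicat_real E x * \<bar>w x\<bar>) \<le> B powr (1 / p) * m powr (1 / q)"
    if B: "B > 0" "A \<le> B" for B
  proof -
    define s where "s = B powr (1 / p)"
    define t where "t = m powr (1 / q)"
    have st: "s > 0" "t > 0" "s powr p = B" "t powr q = m" using B m p q by (auto simp: s_def t_def powr_powr)
    have pw: "indicat_real E x * \<bar>w x\<bar> \<le> s * t * (\<bar>w x\<bar> powr p / (p * B) + indicat_real E x / (q * m))" for x
    proof -
      have "(\<bar>w x\<bar> / s) * (indicat_real E x / t) \<le> (\<bar>w x\<bar> / s) powr p / p + (indicat_real E x / t) powr q / q"
        using p q st by (intro Youngs_inequality) auto
      also have "(\<bar>w x\<bar> / s) powr p = \<bar>w x\<bar> powr p / B" using st by (simp add: powr_divide)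
      also have "(indicat_real E x / t) powr q = indicat_real E x / m"
        using st q by (auto simp: powr_divide indicator_def)
      finally have "s * t * ((\<bar>w x\<bar> / s) * (indicat_real E x / t)) \<le>
          s * t * (\<bar>w x\<bar> powr p / B / p + indicat_real E x / m / q)"
        using st by (intro mult_left_mono) auto
      then show ?thesis using st by (simp add: mult_ac)
    qed
    have "(LINT x|?M. indicat_real E x * \<bar>w x\<bar>) \<le>
        (LINT x|?M. s * t * (\<bar>w x\<bar> powr p / (p * B) + indicat_real E x / (q * m)))"
      by (rule integral_mono[OF iw _ pw]) (intro integrable_mult_right Bochner_Integration.integrable_add integrable_divide_zero wp iE impI)
    also have "\<dots> = s * t * (A / (p * B) + measure lebesgue E / (q * m))"
      using wp iE mE by (simp add: A_def)
    also have "\<dots> \<le> s * t * (1 / p + 1 / q)"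
    proof (intro mult_left_mono add_mono)
      show "A / (p * B) \<le> 1 / p" "measure lebesgue E / (q * m) \<le> 1 / q"
        using B p q m by (auto simp: divide_simps)
    qed (use st in auto)
    finally show ?thesis using q by (simp add: s_def t_def)
  qed
  have "((\<lambda>B. B powr (1 / p) * m powr (1 / q)) \<longlongrightarrow> A powr (1 / p) * m powr (1 / q)) (at_right A)"
    using p A by (intro tendsto_intros) (auto simp: eventually_at_filter)
  moreover have "\<forall>\<^sub>F B in at_right A. (LINT x|?M. indicat_real E x * \<bar>w x\<bar>) \<le> B powr (1 / p) * m powr (1 / q)"
    using est A by (auto simp: eventually_at_filter)
  ultimately show ?thesis
    unfolding q(3) A_def[symmetric] by (intro tendsto_lowerbound) auto
qed

lemma recip_enn2real: "p \<noteq> \<infinity> \<Longrightarrow> p > 0 \<Longrightarrow> recip p = 1 / enn2real p"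
  unfolding recip_def
  by (cases p) (auto simp: inverse_ennreal divide_inverse)

lemma recip_bounds:
  assumes "p > 1"
  shows "0 \<le> recip p" "recip p < 1"
proof -
  show "0 \<le> recip p" by (simp add: recip_def)
  show "recip p < 1"
  proof (cases "p = \<infinity>")
    case False
    moreover have "enn2real p > 1"
      using assms False by (cases p) (auto simp: ennreal_less_iff simp flip: ennreal_1)
    moreover have "p > 0" using assms by (rule order_less_trans[rotated]) simp
    ultimately show ?thesis by (simp add: recip_enn2real)
  qed (simp add: recip_def)
qed

text \<open>For infinite \<open>p\<close> the exponent of \<open>m\<close> is 1 and the essential
  supremum bounds the integrand; otherwise this is Hoelder. The choice \<open>E = \<Omega>\<close>
  yields the total mass \<open>W\<close>, the boundary layer yields the small mass
  \<open>\<eta>\<close>.\<close>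

lemma integral_abs_le_Lp_norm:
  fixes w :: "real^'n \<Rightarrow> real"
  assumes p: "p > 1" and w: "in_Lp \<Omega> p w" "integrable (lebesgue_on \<Omega>) w"
    and \<Omega>: "\<Omega> \<in> lmeasurable" and E: "E \<in> sets lebesgue" "E \<subseteq> \<Omega>" and m: "measure lebesgue E \<le> m" "m > 0"
  shows "(LINT x|lebesgue_on \<Omega>. indicat_real E x * \<bar>w x\<bar>) \<le> Lp_norm \<Omega> p w * m powr (1 - recip p)"
proof (cases "p = \<infinity>")
  case True
  let ?M = "lebesgue_on \<Omega>"
  define S where "S = enn2real (esssup ?M (\<lambda>x. ennreal \<bar>w x\<bar>))"
  have fin: "esssup ?M (\<lambda>x. ennreal \<bar>w x\<bar>) < \<infinity>"
    using w(1) True by (auto simp: in_Lp_def)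
  have S: "S \<ge> 0" "ennreal S = esssup ?M (\<lambda>x. ennreal \<bar>w x\<bar>)" using fin by (simp_all add: S_def)
  have "AE x in ?M. ennreal \<bar>w x\<bar> \<le> ennreal S" unfolding S(2) by (rule esssup_AE)
  then have ae: "AE x in ?M. \<bar>w x\<bar> \<le> S" using S(1) by (simp add: ennreal_le_iff)
  note EM = indicator_integral_lebesgue_on(1)[OF \<Omega> E] and iE = indicator_integral_lebesgue_on(2)[OF \<Omega> E]
    and mE = indicator_integral_lebesgue_on(3)[OF \<Omega> E]
  have "(LINT x|?M. indicat_real E x * \<bar>w x\<bar>) \<le> (LINT x|?M. S * indicat_real E x)"
  proof (rule integral_mono_AE)
    show "integrable ?M (\<lambda>x. indicat_real E x * \<bar>w x\<bar>)"
      using integrable_mult_indicator[OF EM, of "\<lambda>x. \<bar>w x\<bar>"] w(2) by simp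
    show "integrable ?M (\<lambda>x. S * indicat_real E x)" using iE by simp
    show "AE x in ?M. indicat_real E x * \<bar>w x\<bar> \<le> S * indicat_real E x"
      using ae by eventually_elim (auto simp: indicator_def)
  qed
  also have "\<dots> = S * measure lebesgue E" using mE by simp
  also have "\<dots> \<le> S * m" using S m by (intro mult_left_mono)
  finally show ?thesis using True m by (simp add: Lp_norm_def S_def recip_def)
next
  case False
  define P where "P = enn2real p"
  have P: "P > 1" using p False unfolding P_def by (cases p) (auto simp: ennreal_less_iff simp flip: ennreal_1)
  have "p > 0" using p by (rule order_less_trans[rotated]) simp
  then have r: "recip p = 1 / P" using False by (simp add: recip_enn2real P_def)
  show ?thesis
    using integral_abs_le_powr[OF P w(2) _ \<Omega> E m] w(1) False
    by (simp add: in_Lp_def Lp_norm_def r flip: P_def)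
qed

section \<open>The contraction\<close>

text \<open>The function \<open>P * \<bar>w x\<bar> + Q * (indicat_real E x * \<bar>w
  x\<bar>)\<close> dominates the integrand: a fine bound \<open>P\<close> off \<open>E\<close> meets
  the full mass of \<open>\<bar>w\<bar>\<close>, a crude bound \<open>Q\<close> only its mass on
  \<open>E\<close>. The estimates of the nonlocal term are instances, and the existence of the
  integrals comes with them.\<close>

lemma abs_weighted_integral_le:
  fixes w h :: "'a::euclidean_space \<Rightarrow> real"
  assumes \<Omega>: "\<Omega> \<in> lmeasurable" and E: "E \<in> sets lebesgue" "E \<subseteq> \<Omega>"
    and w: "integrable (lebesgue_on \<Omega>) w" and h: "h \<in> borel_measurable (lebesgue_on \<Omega>)"
    and P: "\<And>x. x \<in> \<Omega> - E \<Longrightarrow> \<bar>h x\<bar> \<le> P" "P \<ge> 0" and Q: "\<And>x. x \<in> \<Omega> \<Longrightarrow> \<bar>h x\<bar> \<le> Q"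
    and W: "(LINT x|lebesgue_on \<Omega>. \<bar>w x\<bar>) \<le> W"
    and \<eta>: "(LINT x|lebesgue_on \<Omega>. indicat_real E x * \<bar>w x\<bar>) \<le> \<eta>" "Q \<ge> 0"
  shows "integrable (lebesgue_on \<Omega>) (\<lambda>x. w x * h x)"
    "\<bar>LINT x|lebesgue_on \<Omega>. w x * h x\<bar> \<le> P * W + Q * \<eta>"
proof -
  let ?M = "lebesgue_on \<Omega>"
  have iw: "integrable ?M (\<lambda>x. indicat_real E x * \<bar>w x\<bar>)"
    using integrable_mult_indicator[OF indicator_integral_lebesgue_on(1)[OF \<Omega> E], of "\<lambda>x. \<bar>w x\<bar>"] w by simp
  have pw: "\<bar>w x * h x\<bar> \<le> P * \<bar>w x\<bar> + Q * (indicat_real E x * \<bar>w x\<bar>)" if "x \<in> \<Omega>" for x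
  proof (cases "x \<in> E")
    case True
    then have "\<bar>h x\<bar> * \<bar>w x\<bar> \<le> Q * \<bar>w x\<bar>" "0 \<le> P * \<bar>w x\<bar>"
      using Q[OF that] P(2) by (auto intro: mult_right_mono)
    then show ?thesis using True by (simp add: abs_mult mult.commute)
  next
    case False
    then have "\<bar>h x\<bar> * \<bar>w x\<bar> \<le> P * \<bar>w x\<bar>"
      using P(1)[of x] that by (intro mult_right_mono) auto
    then show ?thesis using False by (simp add: abs_mult mult.commute)
  qed
  have i: "integrable ?M (\<lambda>x. P * \<bar>w x\<bar> + Q * (indicat_real E x * \<bar>w x\<bar>))"
    using w iw by (intro Bochner_Integration.integrable_add integrable_mult_right) auto
  have m: "(\<lambda>x. w x * h x) \<in> borel_measurable ?M" using w h by (intro borel_measurable_times) auto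
  have ae: "AE x in ?M. norm (w x * h x) \<le> P * \<bar>w x\<bar> + Q * (indicat_real E x * \<bar>w x\<bar>)"
    using pw by (intro AE_I2) simp
  show iwh: "integrable ?M (\<lambda>x. w x * h x)"
    by (rule Bochner_Integration.integrable_bound[OF i m])
      (use pw P(2) Q(1) \<eta>(2) in \<open>auto intro!: AE_I2 order_trans[OF _ abs_ge_self]\<close>)
  have "\<bar>LINT x|?M. w x * h x\<bar> \<le> (LINT x|?M. \<bar>w x * h x\<bar>)" by (rule integral_abs_bound)
  also have "\<dots> \<le> (LINT x|?M. P * \<bar>w x\<bar> + Q * (indicat_real E x * \<bar>w x\<bar>))"
    using iwh i pw by (intro integral_mono) auto
  also have "\<dots> = P * (LINT x|?M. \<bar>w x\<bar>) + Q * (LINT x|?M. indicat_real E x * \<bar>w x\<bar>)"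
    using w iw by simp
  also have "\<dots> \<le> P * W + Q * \<eta>" using W \<eta> P(2) by (intro add_mono mult_left_mono)
  finally show "\<bar>LINT x|?M. w x * h x\<bar> \<le> P * W + Q * \<eta>" .
qed

text \<open>Here \<open>B\<close> bounds both the argument of \<open>N\<close> and its distance to
  \<open>r\<close> on all of \<open>\<Omega>\<close>, while \<open>\<rho>\<close> bounds that
  distance off \<open>E\<close>: \<open>R\<close> comes from \<open>\<theta>\<close>,
  \<open>\<bar>r\<bar> * \<epsilon>\<close> from \<open>\<phi> - 1\<close>, and
  \<open>\<epsilon>\<close> from \<open>\<psi>\<close>. The conditions \<open>small\<close> keep the
  argument near \<open>r\<close> off \<open>E\<close>, keep the type II average near
  \<open>r\<close>, map the interval into itself, and make the contraction factor less than
  1.\<close>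

lemma nonlocal_fixed_point:
  fixes w \<phi> \<psi> :: "real^'n \<Rightarrow> real"
  assumes \<Omega>: "\<Omega> \<in> lmeasurable" and E: "E \<in> sets lebesgue" "E \<subseteq> \<Omega>"
    and meas: "\<phi> \<in> borel_measurable (lebesgue_on \<Omega>)" "\<psi> \<in> borel_measurable (lebesgue_on \<Omega>)"
    and \<phi>: "\<And>x. x \<in> \<Omega> \<Longrightarrow> 0 \<le> \<phi> x \<and> \<phi> x \<le> 1" and \<psi>: "\<And>x. x \<in> \<Omega> \<Longrightarrow> \<bar>\<psi> x\<bar> \<le> M"
    and \<epsilon>: "\<And>x. x \<in> \<Omega> - E \<Longrightarrow> \<bar>\<phi> x - 1\<bar> \<le> \<epsilon>" "\<And>x. x \<in> \<Omega> - E \<Longrightarrow> \<bar>\<psi> x\<bar> \<le> \<epsilon>" "\<epsilon> \<ge> 0"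
    and w: "integrable (lebesgue_on \<Omega>) w" "(LINT y|lebesgue_on \<Omega>. w y) = 1"
    and W: "(LINT x|lebesgue_on \<Omega>. \<bar>w x\<bar>) \<le> W"
    and \<eta>: "(LINT x|lebesgue_on \<Omega>. indicat_real E x * \<bar>w x\<bar>) \<le> \<eta>"
    and N: "N r = r" "continuous_on UNIV N"
    and L: "0 < L" "\<And>s t. s \<in> {r-d..r+d} \<Longrightarrow> t \<in> {r-d..r+d} \<Longrightarrow> \<bar>N s - N t\<bar> \<le> L * \<bar>s - t\<bar>"
    and B: "B = \<bar>r\<bar> + 1 + M" "M \<ge> 0"
    and L': "L \<le> L'" "\<And>s t. s \<in> {-B..B} \<Longrightarrow> t \<in> {-B..B} \<Longrightarrow> \<bar>N s - N t\<bar> \<le> L' * \<bar>s - t\<bar>"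
    and R: "0 \<le> R" "R \<le> 1" and \<rho>: "\<rho> = R + (\<bar>r\<bar> + 1) * \<epsilon>"
    and small: "\<rho> \<le> d" "\<rho> * W + B * \<eta> \<le> d" "L * \<rho> * W + L' * B * \<eta> \<le> R" "L * W + L' * \<eta> < 1"
  shows "\<theta> \<in> {-R..R} \<Longrightarrow> nonlocal_defined ty \<Omega> w N (\<lambda>y. (r + \<theta>) * \<phi> y + \<psi> y)"
    and "T_map ty \<Omega> w N \<phi> \<psi> r ` {-R..R} \<subseteq> {-R..R}"
    and "\<exists>!\<theta>. \<theta> \<in> {-R..R} \<and> T_map ty \<Omega> w N \<phi> \<psi> r \<theta> = \<theta>"
proof -
  let ?M = "lebesgue_on \<Omega>"
  define u where "u = (\<lambda>r y. r * \<phi> y + \<psi> y)"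
  note weighted = abs_weighted_integral_le[OF \<Omega> E w(1) _ _ _ _ W \<eta>]
  have "0 \<le> (LINT x|?M. indicat_real E x * \<bar>w x\<bar>)" by (intro integral_nonneg_AE) auto
  then have \<eta>0: "\<eta> \<ge> 0" using \<eta> by linarith
  have "0 \<le> (LINT x|?M. \<bar>w x\<bar>)" by (intro integral_nonneg_AE) auto
  then have W0: "W \<ge> 0" using W by linarith
  have B0: "B \<ge> 0" and \<rho>0: "\<rho> \<ge> 0" and L0: "L' \<ge> 0"
    using B L L'(1) R(1) \<rho> \<epsilon>(3) by auto
  have um: "u (r + \<theta>) \<in> borel_measurable ?M" for \<theta>
    unfolding u_def using meas by (intro borel_measurable_add borel_measurable_times borel_measurable_const)
  have Num: "(\<lambda>y. N (u (r + \<theta>) y)) \<in> borel_measurable ?M" for \<theta>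
    using measurable_compose[OF um borel_measurable_continuous_onI[OF N(2)]] .
  have diff: "\<bar>u (r + \<theta>) x - u (r + \<theta>') x\<bar> \<le> \<bar>\<theta> - \<theta>'\<bar>" if "x \<in> \<Omega>" for \<theta> \<theta>' x
  proof -
    have "u (r + \<theta>) x - u (r + \<theta>') x = (\<theta> - \<theta>') * \<phi> x" by (simp add: u_def algebra_simps)
    then show ?thesis using \<phi>[OF that] by (simp add: abs_mult mult_left_le)
  qed
  have r\<phi>: "\<bar>r * \<phi> x - r\<bar> \<le> \<bar>r\<bar>" "\<bar>r * \<phi> x\<bar> \<le> \<bar>r\<bar>" if "x \<in> \<Omega>" for x
  proof -
    have "\<bar>r * \<phi> x - r\<bar> = \<bar>r\<bar> * \<bar>\<phi> x - 1\<bar>" by (simp add: right_diff_distrib flip: abs_mult)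
    then show "\<bar>r * \<phi> x - r\<bar> \<le> \<bar>r\<bar>" using \<phi>[OF that] by (simp add: mult_left_le)
    show "\<bar>r * \<phi> x\<bar> \<le> \<bar>r\<bar>" using \<phi>[OF that] by (simp add: abs_mult mult_left_le)
  qed
  have eq: "u (r + \<theta>) x = r * \<phi> x + \<theta> * \<phi> x + \<psi> x" for \<theta> x by (simp add: u_def algebra_simps)
  have \<theta>\<phi>: "\<bar>\<theta> * \<phi> x\<bar> \<le> R" if "\<theta> \<in> {-R..R}" "x \<in> \<Omega>" for \<theta> x
  proof -
    have "\<bar>\<theta>\<bar> * \<bar>\<phi> x\<bar> \<le> R * 1" using that \<phi>[OF that(2)] R by (intro mult_mono) auto
    then show ?thesis by (simp add: abs_mult)
  qed
  have uB: "u (r + \<theta>) x \<in> {-B..B}" "\<bar>u (r + \<theta>) x - r\<bar> \<le> B" if "\<theta> \<in> {-R..R}" "x \<in> \<Omega>" for \<theta> x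
    using \<theta>\<phi>[OF that] r\<phi>[OF that(2)] \<psi>[OF that(2)] R(2) unfolding eq B(1) atLeastAtMost_iff by linarith+
  have rB: "r \<in> {-B..B}" using B by auto
  have rd: "r \<in> {r-d..r+d}" using \<rho>0 small(1) by auto
  have u\<rho>: "\<bar>u (r + \<theta>) x - r\<bar> \<le> \<rho>" if "\<theta> \<in> {-R..R}" "x \<in> \<Omega> - E" for \<theta> x
  proof -
    have "\<bar>r * \<phi> x - r\<bar> = \<bar>r\<bar> * \<bar>\<phi> x - 1\<bar>" by (simp add: right_diff_distrib flip: abs_mult)
    also have "\<dots> \<le> \<bar>r\<bar> * \<epsilon>" using \<epsilon>(1)[OF that(2)] by (intro mult_left_mono) auto
    finally have "\<bar>r * \<phi> x - r\<bar> \<le> \<bar>r\<bar> * \<epsilon>" .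
    then show ?thesis
      using \<theta>\<phi>[OF that(1)] that(2) \<epsilon>(2)[OF that(2)] unfolding eq \<rho> distrib_right by fastforce
  qed
  have ud: "u (r + \<theta>) x \<in> {r-d..r+d}" if "\<theta> \<in> {-R..R}" "x \<in> \<Omega> - E" for \<theta> x
    using u\<rho>[OF that] small(1) by auto
  have main: "nonlocal_defined ty \<Omega> w N (u (r + \<theta>)) \<and> \<bar>T_map ty \<Omega> w N \<phi> \<psi> r \<theta>\<bar> \<le> R \<and>
      \<bar>T_map ty \<Omega> w N \<phi> \<psi> r \<theta> - T_map ty \<Omega> w N \<phi> \<psi> r \<theta>'\<bar> \<le> (L * W + L' * \<eta>) * \<bar>\<theta> - \<theta>'\<bar>"
    if \<theta>: "\<theta> \<in> {-R..R}" and \<theta>': "\<theta>' \<in> {-R..R}" for \<theta> \<theta>'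
  proof (cases ty)
    case TypeI
    have T: "T_map ty \<Omega> w N \<phi> \<psi> r \<theta> = (LINT y|?M. w y * N (u (r + \<theta>) y)) - r" for \<theta>
      by (simp add: T_map_def TypeI u_def)
    have off: "\<bar>N (u (r + \<theta>) x) - r\<bar> \<le> L * \<rho>" if "\<theta> \<in> {-R..R}" "x \<in> \<Omega> - E" for \<theta> x
    proof -
      have "\<bar>N (u (r + \<theta>) x) - N r\<bar> \<le> L * \<bar>u (r + \<theta>) x - r\<bar>" by (rule L(2)[OF ud[OF that] rd])
      also have "\<dots> \<le> L * \<rho>" using L(1) u\<rho>[OF that] by (intro mult_left_mono) auto
      finally show ?thesis using N(1) by simp
    qed
    have all: "\<bar>N (u (r + \<theta>) x) - r\<bar> \<le> L' * B" if "\<theta> \<in> {-R..R}" "x \<in> \<Omega>" for \<theta> x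
    proof -
      have "\<bar>N (u (r + \<theta>) x) - N r\<bar> \<le> L' * \<bar>u (r + \<theta>) x - r\<bar>" by (rule L'(2)[OF uB(1)[OF that] rB])
      also have "\<dots> \<le> L' * B" using L0 uB(2)[OF that] by (intro mult_left_mono) auto
      finally show ?thesis using N(1) by simp
    qed
    have ii: "integrable ?M (\<lambda>y. w y * (N (u (r + \<theta>) y) - r))"
      "\<bar>LINT y|?M. w y * (N (u (r + \<theta>) y) - r)\<bar> \<le> L * \<rho> * W + L' * B * \<eta>"
      if \<theta>: "\<theta> \<in> {-R..R}" for \<theta>
      using weighted[of "\<lambda>y. N (u (r + \<theta>) y) - r" "L * \<rho>" "L' * B"] off[OF \<theta>] all[OF \<theta>] Num L L0 \<rho>0 B0
      by (simp_all add: borel_measurable_diff)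
    have i: "integrable ?M (\<lambda>y. w y * N (u (r + \<theta>) y))" if "\<theta> \<in> {-R..R}" for \<theta>
      using Bochner_Integration.integrable_add[OF ii(1)[OF that] integrable_mult_left[OF w(1), of r]]
      by (simp add: algebra_simps)
    \<comment> \<open>Because \<open>w\<close> has integral 1, the constant \<open>r\<close> can be
      taken under the integral.\<close>
    have "(LINT y|?M. w y * (N (u (r + \<theta>) y) - r)) = T_map ty \<Omega> w N \<phi> \<psi> r \<theta>"
      using i[OF \<theta>] w by (simp add: T right_diff_distrib)
    then have 1: "\<bar>T_map ty \<Omega> w N \<phi> \<psi> r \<theta>\<bar> \<le> R" using ii(2)[OF \<theta>] small(3) by linarith
    have "\<bar>LINT y|?M. w y * (N (u (r + \<theta>) y) - N (u (r + \<theta>') y))\<bar> \<le>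
        L * \<bar>\<theta> - \<theta>'\<bar> * W + L' * \<bar>\<theta> - \<theta>'\<bar> * \<eta>"
    proof (rule weighted(2))
      show "(\<lambda>y. N (u (r + \<theta>) y) - N (u (r + \<theta>') y)) \<in> borel_measurable ?M"
        using Num by (intro borel_measurable_diff)
      show "\<bar>N (u (r + \<theta>) x) - N (u (r + \<theta>') x)\<bar> \<le> L * \<bar>\<theta> - \<theta>'\<bar>" if "x \<in> \<Omega> - E" for x
      proof -
        have "\<bar>N (u (r + \<theta>) x) - N (u (r + \<theta>') x)\<bar> \<le> L * \<bar>u (r + \<theta>) x - u (r + \<theta>') x\<bar>"
          by (rule L(2)[OF ud[OF \<theta> that] ud[OF \<theta>' that]])
        also have "\<dots> \<le> L * \<bar>\<theta> - \<theta>'\<bar>" using L(1) that diff[of x] by (intro mult_left_mono) auto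
        finally show ?thesis .
      qed
      show "\<bar>N (u (r + \<theta>) x) - N (u (r + \<theta>') x)\<bar> \<le> L' * \<bar>\<theta> - \<theta>'\<bar>" if "x \<in> \<Omega>" for x
      proof -
        have "\<bar>N (u (r + \<theta>) x) - N (u (r + \<theta>') x)\<bar> \<le> L' * \<bar>u (r + \<theta>) x - u (r + \<theta>') x\<bar>"
          by (rule L'(2)[OF uB(1)[OF \<theta> that] uB(1)[OF \<theta>' that]])
        also have "\<dots> \<le> L' * \<bar>\<theta> - \<theta>'\<bar>" using L0 that diff[of x] by (intro mult_left_mono) auto
        finally show ?thesis .
      qed
    qed (use L L0 in auto)
    moreover have "(LINT y|?M. w y * (N (u (r + \<theta>) y) - N (u (r + \<theta>') y))) =
        T_map ty \<Omega> w N \<phi> \<psi> r \<theta> - T_map ty \<Omega> w N \<phi> \<psi> r \<theta>'"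
      using i[OF \<theta>] i[OF \<theta>'] by (simp add: T right_diff_distrib)
    ultimately have 2: "\<bar>T_map ty \<Omega> w N \<phi> \<psi> r \<theta> - T_map ty \<Omega> w N \<phi> \<psi> r \<theta>'\<bar> \<le> (L * W + L' * \<eta>) * \<bar>\<theta> - \<theta>'\<bar>"
      by (simp add: algebra_simps)
    show ?thesis using 1 2 i[OF \<theta>] by (simp add: TypeI)
  next
    case TypeII
    define U where "U \<theta> = (LINT y|?M. w y * u (r + \<theta>) y)" for \<theta>
    have T: "T_map ty \<Omega> w N \<phi> \<psi> r \<theta> = N (U \<theta>) - r" for \<theta>
      by (simp add: T_map_def TypeII u_def U_def)
    have ii: "integrable ?M (\<lambda>y. w y * (u (r + \<theta>) y - r))"
      "\<bar>LINT y|?M. w y * (u (r + \<theta>) y - r)\<bar> \<le> \<rho> * W + B * \<eta>"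
      if \<theta>: "\<theta> \<in> {-R..R}" for \<theta>
      using weighted[of "\<lambda>y. u (r + \<theta>) y - r" \<rho> B] u\<rho>[OF \<theta>] uB(2)[OF \<theta>] um \<rho>0 B0
      by (simp_all add: borel_measurable_diff)
    have i: "integrable ?M (\<lambda>y. w y * u (r + \<theta>) y)" if "\<theta> \<in> {-R..R}" for \<theta>
      using Bochner_Integration.integrable_add[OF ii(1)[OF that] integrable_mult_left[OF w(1), of r]]
      by (simp add: algebra_simps)
    have U: "\<bar>U \<theta> - r\<bar> \<le> \<rho> * W + B * \<eta>" if "\<theta> \<in> {-R..R}" for \<theta>
      using ii(2)[OF that] i[OF that] w by (simp add: U_def right_diff_distrib)
    then have Ud: "U \<theta> \<in> {r-d..r+d}" if "\<theta> \<in> {-R..R}" for \<theta>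
      using U[OF that] small(2) by auto
    have "\<bar>N (U \<theta>) - N r\<bar> \<le> L * \<bar>U \<theta> - r\<bar>" by (rule L(2)[OF Ud[OF \<theta>] rd])
    also have "\<dots> \<le> L * (\<rho> * W + B * \<eta>)" using L(1) U[OF \<theta>] by (intro mult_left_mono) auto
    \<comment> \<open>For type II only \<open>L\<close> acts; weakening it to \<open>L'\<close> in
      the layer term gives the type I bound, so one set of smallness conditions serves both
      types.\<close>
    also have "\<dots> \<le> L * \<rho> * W + L' * B * \<eta>"
      using mult_right_mono[OF L'(1), of "B * \<eta>"] B0 \<eta>0 by (simp add: algebra_simps)
    finally have 1: "\<bar>T_map ty \<Omega> w N \<phi> \<psi> r \<theta>\<bar> \<le> R" using small(3) N(1) by (simp add: T)
    have "\<bar>LINT y|?M. w y * (u (r + \<theta>) y - u (r + \<theta>') y)\<bar> \<le> \<bar>\<theta> - \<theta>'\<bar> * W + \<bar>\<theta> - \<theta>'\<bar> * \<eta>"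
      using um diff by (intro weighted(2)) (auto intro: borel_measurable_diff)
    then have "\<bar>U \<theta> - U \<theta>'\<bar> \<le> (W + \<eta>) * \<bar>\<theta> - \<theta>'\<bar>"
      using i[OF \<theta>] i[OF \<theta>'] by (simp add: U_def right_diff_distrib algebra_simps)
    then have "L * \<bar>U \<theta> - U \<theta>'\<bar> \<le> L * ((W + \<eta>) * \<bar>\<theta> - \<theta>'\<bar>)" using L(1) by (intro mult_left_mono) auto
    also have "\<dots> = (L * W + L * \<eta>) * \<bar>\<theta> - \<theta>'\<bar>" by (simp add: algebra_simps)
    also have "\<dots> \<le> (L * W + L' * \<eta>) * \<bar>\<theta> - \<theta>'\<bar>"
      using L'(1) \<eta>0 by (intro mult_right_mono add_left_mono) auto
    finally have 2: "\<bar>T_map ty \<Omega> w N \<phi> \<psi> r \<theta> - T_map ty \<Omega> w N \<phi> \<psi> r \<theta>'\<bar> \<le> (L * W + L' * \<eta>) * \<bar>\<theta> - \<theta>'\<bar>"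
      using L(2)[OF Ud[OF \<theta>] Ud[OF \<theta>']] by (simp add: T)
    show ?thesis using 1 2 i[OF \<theta>] by (simp add: TypeII)
  qed
  show "\<theta> \<in> {-R..R} \<Longrightarrow> nonlocal_defined ty \<Omega> w N (\<lambda>y. (r + \<theta>) * \<phi> y + \<psi> y)"
    using main[of \<theta> \<theta>] by (simp add: u_def)
  show maps: "T_map ty \<Omega> w N \<phi> \<psi> r ` {-R..R} \<subseteq> {-R..R}"
  proof (rule image_subsetI)
    fix \<theta> assume \<theta>: "\<theta> \<in> {-R..R}"
    have "\<bar>T_map ty \<Omega> w N \<phi> \<psi> r \<theta>\<bar> \<le> R" using main[OF \<theta> \<theta>] by blast
    then show "T_map ty \<Omega> w N \<phi> \<psi> r \<theta> \<in> {-R..R}" by auto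
  qed
  have "\<exists>!\<theta>\<in>{-R..R}. T_map ty \<Omega> w N \<phi> \<psi> r \<theta> = \<theta>"
  proof (rule Banach_fix)
    show "complete {-R..R}" by (simp add: complete_eq_closed)
    show "{-R..R} \<noteq> {}" using R(1) by simp
    show "0 \<le> L * W + L' * \<eta>" using L(1) W0 L0 \<eta>0 by simp
    show "dist (T_map ty \<Omega> w N \<phi> \<psi> r x) (T_map ty \<Omega> w N \<phi> \<psi> r y) \<le> (L * W + L' * \<eta>) * dist x y"
      if "x \<in> {-R..R}" "y \<in> {-R..R}" for x y
      using main[OF that] by (simp add: dist_real_def)
  qed (use small(4) maps in auto)
  then show "\<exists>!\<theta>. \<theta> \<in> {-R..R} \<and> T_map ty \<Omega> w N \<phi> \<psi> r \<theta> = \<theta>" .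
qed

section \<open>Uniform constants and asymptotics in the parameter\<close>

lemma locally_lipschitz_real:
  fixes N :: "real \<Rightarrow> real"
  assumes "\<forall>x. \<exists>e>0. \<exists>L. L-lipschitz_on (cball x e) N"
  shows "continuous_on UNIV N" "\<exists>L. L-lipschitz_on {a..b} N"
proof -
  \<comment> \<open>The notion concerns families depending on time; a constant family over the
    single time 0 gives access to the passage from local to uniform constants on compact
    sets.\<close>
  have "local_lipschitz {0::real} {a..b} (\<lambda>_. N)" for a b
  proof (rule local_lipschitzI)
    fix t x :: real
    obtain e L where "e > 0" "L-lipschitz_on (cball x e) N" using assms by blast
    then show "\<exists>u>0. \<exists>L. \<forall>t\<in>cball t u \<inter> {0}. L-lipschitz_on (cball x u \<inter> {a..b}) N"
      using lipschitz_on_subset[of L "cball x e" N "cball x e \<inter> {a..b}"] by blast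
  qed
  then obtain L where "\<And>t. t \<in> {0::real} \<Longrightarrow> L-lipschitz_on {a..b} N"
    by (rule local_lipschitz_compact_implies_lipschitz) auto
  then show "\<exists>L. L-lipschitz_on {a..b} N" by blast
  have "isCont N x" for x
  proof -
    obtain e L where "e > 0" "L-lipschitz_on (cball x e) N" using assms by blast
    then have "continuous_on (ball x e) N"
      using lipschitz_on_continuous_on continuous_on_subset ball_subset_cball by metis
    then show ?thesis using \<open>e > 0\<close> by (simp add: continuous_on_eq_continuous_at)
  qed
  then show "continuous_on UNIV N" by (simp add: continuous_at_imp_continuous_on)
qed

text \<open>The problem is invariant under a change of sign, so the one-sided bounds for
  \<open>v\<close> and \<open>- v\<close> combine.\<close>

lemma robin_solution_estimates:
  fixes v :: "real^'n \<Rightarrow> real"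
  assumes dom: "bounded_smooth_domain \<Omega>" "\<forall>x\<in>frontier \<Omega>. unit_outward_normal \<Omega> x (\<nu> x)"
    and a: "\<And>x. x \<in> \<Omega> \<Longrightarrow> positive_definite (a x)" "\<And>x. x \<in> \<Omega> \<Longrightarrow> trace (a x) \<le> K"
    and \<beta>: "\<And>x. x \<in> \<Omega> \<Longrightarrow> norm (\<beta> x) \<le> K"
    and c: "c0 > 0" "\<And>x. x \<in> \<Omega> \<Longrightarrow> c x \<ge> c0"
    and b: "\<And>x. x \<in> frontier \<Omega> \<Longrightarrow> b x \<ge> 0" and g: "\<And>x. x \<in> frontier \<Omega> \<Longrightarrow> \<bar>g x\<bar> \<le> M" "M \<ge> 0"
    and v: "continuous_on (closure \<Omega>) v" "nondivergence_solution \<Omega> a \<beta> c v" "robin_condition \<Omega> \<nu> b g v"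
  shows "x \<in> closure \<Omega> \<Longrightarrow> \<bar>v x\<bar> \<le> M"
    and "x \<in> \<Omega> \<Longrightarrow> x \<notin> boundary_layer \<Omega> \<delta> \<Longrightarrow> 0 < \<delta> \<Longrightarrow> \<delta> \<le> 1 \<Longrightarrow> \<bar>v x\<bar> \<le> 4 * M * K / (c0 * \<delta>\<^sup>2)"
proof -
  have \<Omega>: "open \<Omega>" "bounded \<Omega>" using dom(1) by (auto simp: bounded_smooth_domain_def)
  have c': "c x > 0" if "x \<in> \<Omega>" for x using c(2)[OF that] c(1) by linarith
  have v': "continuous_on (closure \<Omega>) (\<lambda>x. - v x)" using v(1) by (intro continuous_intros)
  note neg = v' nondivergence_solution_uminus[OF v(2)] robin_condition_uminus[OF v(3)]
  have bd: "v x \<le> M" "- v x \<le> M" if "x \<in> closure \<Omega>" for x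
  proof -
    have gM: "g x \<le> M" "- g x \<le> M" if "x \<in> frontier \<Omega>" for x using g(1)[OF that] by linarith+
    show "v x \<le> M" by (rule maximum_principle[OF \<Omega> dom(2) v a(1) c' b gM(1) g(2) that])
    show "- v x \<le> M" by (rule maximum_principle[OF \<Omega> dom(2) neg a(1) c' b gM(2) g(2) that])
  qed
  show "x \<in> closure \<Omega> \<Longrightarrow> \<bar>v x\<bar> \<le> M" using bd[of x] by linarith
  show "\<bar>v x\<bar> \<le> 4 * M * K / (c0 * \<delta>\<^sup>2)" if x: "x \<in> \<Omega>" "x \<notin> boundary_layer \<Omega> \<delta>" and \<delta>: "0 < \<delta>" "\<delta> \<le> 1"
  proof -
    have "v x \<le> 4 * M * K / (c0 * \<delta>\<^sup>2)"
      by (rule interior_decay[OF \<Omega>(1) v(1,2) a \<beta> c g(2) bd(1) \<delta> ball_subset_domain[OF x]])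
    moreover have "- v x \<le> 4 * M * K / (c0 * \<delta>\<^sup>2)"
      by (rule interior_decay[OF \<Omega>(1) neg(1,2) a \<beta> c g(2) bd(2) \<delta> ball_subset_domain[OF x]])
    ultimately show ?thesis by linarith
  qed
qed

text \<open>The critical condition is the self-mapping one, since both of its sides tend to 0.
  Relative to \<open>R\<close>, the error \<open>\<epsilon>\<close> has exponent
  \<open>s / 4 - 3 / 8\<close>, negative because \<open>s \<le> 1\<close>, and \<open>\<eta>\<close>
  has exponent \<open>- s / 16\<close>.\<close>

lemma eventually_contraction_parameters:
  fixes s :: real
  assumes s: "0 < s" "s \<le> 1" and "L * W < 1" "d > 0"
  shows "\<forall>\<^sub>F lam in at_top. \<forall>R \<epsilon> \<eta> \<rho>. R = lam powr (- s / 4) \<longrightarrow> \<epsilon> = C * lam powr (- 3 / 8) \<longrightarrow>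
      \<eta> = H * lam powr (- 5 * s / 16) \<longrightarrow> \<rho> = R + c * \<epsilon> \<longrightarrow>
      R \<le> 1 \<and> \<rho> \<le> d \<and> \<rho> * W + B * \<eta> \<le> d \<and> L * \<rho> * W + L' * B * \<eta> \<le> R \<and> L * W + L' * \<eta> < 1"
proof -
  define R where "R lam = lam powr (- s / 4)" for lam :: real
  define \<epsilon> where "\<epsilon> lam = C * lam powr (- 3 / 8)" for lam :: real
  define \<eta> where "\<eta> lam = H * lam powr (- 5 * s / 16)" for lam :: real
  define \<rho> where "\<rho> lam = R lam + c * \<epsilon> lam" for lam
  have pow: "((\<lambda>lam::real. lam powr e) \<longlongrightarrow> 0) at_top" if "e < 0" for e
    using that by (rule tendsto_neg_powr) (rule filterlim_ident)
  have R0: "(R \<longlongrightarrow> 0) at_top" unfolding R_def using s by (intro pow) simp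
  have \<epsilon>0: "(\<epsilon> \<longlongrightarrow> 0) at_top" unfolding \<epsilon>_def by (intro tendsto_mult_right_zero pow) simp
  have \<eta>0: "(\<eta> \<longlongrightarrow> 0) at_top" unfolding \<eta>_def using s by (intro tendsto_mult_right_zero pow) simp
  have \<epsilon>R: "((\<lambda>lam. C * lam powr (s / 4 - 3 / 8)) \<longlongrightarrow> 0) at_top"
    using s by (intro tendsto_mult_right_zero pow) simp
  have \<eta>R: "((\<lambda>lam. H * lam powr (- s / 16)) \<longlongrightarrow> 0) at_top"
    using s by (intro tendsto_mult_right_zero pow) simp
  have \<rho>0: "(\<rho> \<longlongrightarrow> 0) at_top"
    unfolding \<rho>_def using tendsto_add[OF R0 tendsto_mult_right_zero[OF \<epsilon>0, of c]] by simp
  have 1: "\<forall>\<^sub>F lam in at_top. R lam < 1" using R0 by (rule order_tendstoD) simp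
  have 2: "\<forall>\<^sub>F lam in at_top. \<rho> lam < d" using \<rho>0 \<open>d > 0\<close> by (rule order_tendstoD)
  have "((\<lambda>lam. \<rho> lam * W + B * \<eta> lam) \<longlongrightarrow> 0 * W + B * 0) at_top"
    by (intro tendsto_intros \<rho>0 \<eta>0)
  then have 3: "\<forall>\<^sub>F lam in at_top. \<rho> lam * W + B * \<eta> lam < d" using \<open>d > 0\<close> by (intro order_tendstoD) auto
  \<comment> \<open>This is the left side of the self-mapping condition divided by \<open>R\<close>;
    its limit \<open>L * W\<close> is less than 1.\<close>
  have "((\<lambda>lam. L * (1 + c * (C * lam powr (s / 4 - 3 / 8))) * W + L' * B * (H * lam powr (- s / 16)))
      \<longlongrightarrow> L * (1 + c * 0) * W + L' * B * 0) at_top"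
    by (intro tendsto_intros \<epsilon>R \<eta>R)
  then have 4: "\<forall>\<^sub>F lam in at_top.
      L * (1 + c * (C * lam powr (s / 4 - 3 / 8))) * W + L' * B * (H * lam powr (- s / 16)) < 1"
    using \<open>L * W < 1\<close> by (intro order_tendstoD) auto
  have "((\<lambda>lam. L * W + L' * \<eta> lam) \<longlongrightarrow> L * W + L' * 0) at_top" by (intro tendsto_intros \<eta>0)
  then have 5: "\<forall>\<^sub>F lam in at_top. L * W + L' * \<eta> lam < 1" using \<open>L * W < 1\<close> by (intro order_tendstoD) auto
  show ?thesis
    using 1 2 3 4 5 eventually_gt_at_top[of 0]
  proof eventually_elim
    case (elim lam)
    have "R lam * lam powr (s / 4 - 3 / 8) = lam powr (- 3 / 8)" "R lam * lam powr (- s / 16) = lam powr (- 5 * s / 16)"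
      by (simp_all add: R_def flip: powr_add)
    then have e: "\<epsilon> lam = R lam * (C * lam powr (s / 4 - 3 / 8))" "\<eta> lam = R lam * (H * lam powr (- s / 16))"
      by (simp_all add: \<epsilon>_def \<eta>_def mult_ac)
    have "L * \<rho> lam * W + L' * B * \<eta> lam =
        R lam * (L * (1 + c * (C * lam powr (s / 4 - 3 / 8))) * W + L' * B * (H * lam powr (- s / 16)))"
      unfolding \<rho>_def e by (simp add: algebra_simps)
    also have "\<dots> \<le> R lam * 1" using elim(4) by (intro mult_left_mono) (auto simp: R_def)
    finally have "L * \<rho> lam * W + L' * B * \<eta> lam \<le> R lam" by simp
    then show ?case using elim unfolding \<rho>_def R_def \<epsilon>_def \<eta>_def by auto
  qed
qed

section \<open>Assembly of the estimates\<close>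

theorem proposition2p1:
  fixes \<Omega> :: "(real^'n) set"
    and \<nu> :: "real^'n \<Rightarrow> real^'n"
    and D :: "real^'n \<Rightarrow> real^'n^'n"
    and d\<^sub>0 :: real
    and f b g w :: "real^'n \<Rightarrow> real"
    and p :: ennreal
    and N :: "real \<Rightarrow> real"
    and ty :: nonlocal_type
    and \<Phi> \<Psi> :: "real \<Rightarrow> real^'n \<Rightarrow> real"
  assumes "bounded_smooth_domain \<Omega>"
    and "\<forall>x\<in>frontier \<Omega>. unit_outward_normal \<Omega> x (\<nu> x)"
    and "\<forall>x\<in>closure \<Omega>. transpose (D x) = D x"
    and "\<forall>i j. C1_closure \<Omega> (\<lambda>x. D x $ i $ j)"
    and "d\<^sub>0 > 0"
    and "\<forall>x\<in>closure \<Omega>. \<forall>z. (\<Sum>i\<in>UNIV. \<Sum>j\<in>UNIV. D x $ i $ j * z $ i * z $ j) \<ge> d\<^sub>0 * (norm z)\<^sup>2"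
    and "continuous_on (closure \<Omega>) f" and "\<forall>x\<in>closure \<Omega>. f x > 0"
    and "continuous_on (frontier \<Omega>) b" and "\<forall>x\<in>frontier \<Omega>. b x \<ge> 0"
    and "continuous_on (frontier \<Omega>) g"
    and "p > 1" and "in_Lp \<Omega> p w" and "(LINT y|lebesgue_on \<Omega>. w y) = 1"
    and "\<forall>x. \<exists>e>0. \<exists>L. L-lipschitz_on (cball x e) N"
    and "\<forall>lam>0. classical_solution \<Omega> \<nu> D (\<lambda>x s. lam * f x * (s - 1)) b (\<lambda>x. 0) (\<Phi> lam)"
    and "\<forall>lam>0. classical_solution \<Omega> \<nu> D (\<lambda>x s. lam * f x * s) b g (\<Psi> lam)"
    and "\<exists>r\<^sub>1\<in>S_star \<Omega> p w N. \<exists>r\<^sub>2\<in>S_star \<Omega> p w N. r\<^sub>1 \<noteq> r\<^sub>2"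
  shows "\<forall>r\<in>S_star \<Omega> p w N. \<exists>lam0>0. \<forall>lam>lam0.
    (\<forall>\<theta>\<in>I_int p lam. nonlocal_defined ty \<Omega> w N (\<lambda>y. (r + \<theta>) * \<Phi> lam y + \<Psi> lam y)) \<and>
    T_map ty \<Omega> w N (\<Phi> lam) (\<Psi> lam) r ` I_int p lam \<subseteq> I_int p lam \<and>
    (\<exists>!\<theta>. \<theta> \<in> I_int p lam \<and> T_map ty \<Omega> w N (\<Phi> lam) (\<Psi> lam) r \<theta> = \<theta>)"
proof
  fix r assume "r \<in> S_star \<Omega> p w N"
  then obtain d L where r: "N r = r" and d: "d > 0" and L: "0 < L"
      "L < measure lebesgue \<Omega> powr (recip p - 1) / Lp_norm \<Omega> p w"
      "\<And>s t. s \<in> {r-d..r+d} \<Longrightarrow> t \<in> {r-d..r+d} \<Longrightarrow> \<bar>N s - N t\<bar> \<le> L * \<bar>s - t\<bar>"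
    unfolding S_star_def by auto
  have \<Omega>: "open \<Omega>" "bounded \<Omega>" "\<Omega> \<noteq> {}" using assms(1) by (auto simp: bounded_smooth_domain_def)
  have lm: "\<Omega> \<in> lmeasurable" using \<Omega> by (intro lmeasurable_open)
  have sub: "\<Omega> \<subseteq> closure \<Omega>" by (rule closure_subset)
  define s where "s = 1 - recip p"
  have s: "0 < s" "s \<le> 1" using recip_bounds[OF assms(12)] by (auto simp: s_def)
  define A where "A = Lp_norm \<Omega> p w"
  define V where "V = measure lebesgue \<Omega>"
  \<comment> \<open>Division by 0 and powers of base 0 are 0 by convention, so positivity of this
    quotient yields \<open>A > 0\<close> and \<open>V > 0\<close>.\<close>
  have "V powr (recip p - 1) / A > 0" using L(1,2) unfolding A_def V_def by linarith
  moreover have "A \<ge> 0" by (simp add: A_def Lp_norm_def)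
  ultimately have A: "A > 0" and V: "V > 0"
    by (auto simp: zero_less_divide_iff V_def less_le)
  \<comment> \<open>Hoelder's bound for the integral of \<open>\<bar>w\<bar>\<close> over
    \<open>\<Omega>\<close>; the upper bound on \<open>L\<close> in \<open>S_star\<close> says
    precisely that \<open>L * W < 1\<close>.\<close>
  define W where "W = A * V powr s"
  have "L * A < V powr (- s)" using L(2) A unfolding s_def A_def V_def by (simp add: field_simps)
  then have "L * A * V powr s < V powr (- s) * V powr s" using V by (intro mult_strict_right_mono) auto
  then have LW: "L * W < 1" using V by (simp add: W_def powr_minus mult.assoc)
  \<comment> \<open>A function that is not integrable would have integral 0 instead of 1.\<close>
  have wi: "integrable (lebesgue_on \<Omega>) w"
    using assms(14) not_integrable_integral_eq by (metis zero_neq_one)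
  have W: "(LINT x|lebesgue_on \<Omega>. \<bar>w x\<bar>) \<le> W"
  proof -
    have "(LINT x|lebesgue_on \<Omega>. \<bar>w x\<bar>) = (LINT x|lebesgue_on \<Omega>. indicat_real \<Omega> x * \<bar>w x\<bar>)"
      by (intro Bochner_Integration.integral_cong) auto
    also have "\<dots> \<le> A * V powr (1 - recip p)" unfolding A_def
      by (rule integral_abs_le_Lp_norm[OF assms(12,13) wi lm fmeasurableD[OF lm] subset_refl]) (use V in \<open>auto simp: V_def\<close>)
    finally show ?thesis by (simp add: W_def s_def)
  qed
  obtain K1 where K1: "K1 > 0" "\<And>\<delta>. 0 < \<delta> \<Longrightarrow> \<delta> \<le> 1 \<Longrightarrow> measure lebesgue (boundary_layer \<Omega> \<delta>) \<le> K1 * \<delta>"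
    using measure_boundary_layer_le[OF assms(1)] by auto
  obtain Ka Kb where "\<forall>x\<in>\<Omega>. trace (D x) \<le> Ka" "\<forall>x\<in>\<Omega>. norm (column_divergence D x) \<le> Kb"
    using trace_bounded[OF \<Omega>(2) assms(4)] column_divergence_bounded[OF \<Omega>(2) assms(4)] by blast
  then obtain K where K: "\<And>x. x \<in> \<Omega> \<Longrightarrow> trace (D x) \<le> K" "\<And>x. x \<in> \<Omega> \<Longrightarrow> norm (column_divergence D x) \<le> K"
    by (metis max.coboundedI1 max.coboundedI2)
  have K0: "K \<ge> 0" using K(2) \<Omega>(3) norm_ge_zero order_trans by blast
  have "\<exists>y\<in>closure \<Omega>. \<forall>x\<in>closure \<Omega>. f y \<le> f x"
    using \<Omega> assms(7) by (intro continuous_attains_inf) auto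
  then obtain f0 where f0: "f0 > 0" "\<And>x. x \<in> \<Omega> \<Longrightarrow> f x \<ge> f0" using assms(8) sub by blast
  have "bounded (g ` frontier \<Omega>)"
    using compact_imp_bounded[OF compact_continuous_image[OF assms(11) compact_frontier_bounded[OF \<Omega>(2)]]] .
  then obtain Mg where "\<And>x. x \<in> frontier \<Omega> \<Longrightarrow> \<bar>g x\<bar> \<le> Mg" unfolding bounded_iff by auto
  \<comment> \<open>With \<open>M \<ge> 1\<close> the same constant also bounds the datum -1 of
    \<open>\<Phi> - 1\<close>, so both solutions share the error \<open>\<epsilon>\<close>.\<close>
  then obtain M where M: "M \<ge> 1" "\<And>x. x \<in> frontier \<Omega> \<Longrightarrow> \<bar>g x\<bar> \<le> M"
    by (metis max.coboundedI1 max.coboundedI2 order_refl)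
  have pd: "positive_definite (D x)" if "x \<in> \<Omega>" for x
    unfolding positive_definite_def
  proof (intro conjI allI impI)
    show "transpose (D x) = D x" using assms(3) sub that by blast
    fix z :: "real^'n" assume "z \<noteq> 0"
    then have "0 < d\<^sub>0 * (norm z)\<^sup>2" using assms(5) by simp
    then show "(\<Sum>i\<in>UNIV. \<Sum>j\<in>UNIV. D x $ i $ j * z $ i * z $ j) > 0"
      using assms(6) sub that by (meson less_le_trans subsetD)
  qed
  have N: "continuous_on UNIV N" by (rule locally_lipschitz_real(1)[OF assms(15)])
  define B where "B = \<bar>r\<bar> + 1 + M"
  obtain L1 where L1: "L1-lipschitz_on {-B..B} N" using locally_lipschitz_real(2)[OF assms(15)] by blast
  define L' where "L' = max L L1"
  have L': "\<bar>N s - N t\<bar> \<le> L' * \<bar>s - t\<bar>" if "s \<in> {-B..B}" "t \<in> {-B..B}" for s t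
  proof -
    have "\<bar>N s - N t\<bar> \<le> L1 * \<bar>s - t\<bar>" using lipschitz_onD[OF L1 that] by (simp add: dist_real_def)
    also have "\<dots> \<le> L' * \<bar>s - t\<bar>" by (intro mult_right_mono) (auto simp: L'_def)
    finally show ?thesis .
  qed
  define C where "C = 4 * M * K / f0"
  define H where "H = A * K1 powr s"
  obtain lam1 where lam1: "\<And>lam R \<epsilon> \<eta> \<rho>. lam \<ge> lam1 \<Longrightarrow> R = lam powr (- s / 4) \<Longrightarrow> \<epsilon> = C * lam powr (- 3 / 8) \<Longrightarrow>
      \<eta> = H * lam powr (- 5 * s / 16) \<Longrightarrow> \<rho> = R + (\<bar>r\<bar> + 1) * \<epsilon> \<Longrightarrow>
      R \<le> 1 \<and> \<rho> \<le> d \<and> \<rho> * W + B * \<eta> \<le> d \<and> L * \<rho> * W + L' * B * \<eta> \<le> R \<and> L * W + L' * \<eta> < 1"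
    using eventually_contraction_parameters[OF s LW d, of C H "\<bar>r\<bar> + 1" B L']
    unfolding eventually_at_top_linorder by blast
  show "\<exists>lam0>0. \<forall>lam>lam0.
    (\<forall>\<theta>\<in>I_int p lam. nonlocal_defined ty \<Omega> w N (\<lambda>y. (r + \<theta>) * \<Phi> lam y + \<Psi> lam y)) \<and>
    T_map ty \<Omega> w N (\<Phi> lam) (\<Psi> lam) r ` I_int p lam \<subseteq> I_int p lam \<and>
    (\<exists>!\<theta>. \<theta> \<in> I_int p lam \<and> T_map ty \<Omega> w N (\<Phi> lam) (\<Psi> lam) r \<theta> = \<theta>)"
  \<comment> \<open>The 1 ensures a positive threshold and \<open>\<delta> \<le> 1\<close>, as the
    layer and decay estimates require.\<close>
  proof (intro exI[of _ "max 1 lam1"] conjI allI impI)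
    fix lam assume "max 1 lam1 < lam"
    then have lam: "lam > 0" "lam \<ge> 1" "lam \<ge> lam1" by auto
    define \<delta> where "\<delta> = lam powr (- 5 / 16)"
    have \<delta>: "0 < \<delta>" "\<delta> \<le> 1"
      using lam powr_mono[of "- 5 / 16" 0 lam] by (auto simp: \<delta>_def)
    define E where "E = boundary_layer \<Omega> \<delta> \<inter> \<Omega>"
    define R where "R = lam powr (- s / 4)"
    define \<epsilon> where "\<epsilon> = C * lam powr (- 3 / 8)"
    define \<eta> where "\<eta> = H * lam powr (- 5 * s / 16)"
    define \<rho> where "\<rho> = R + (\<bar>r\<bar> + 1) * \<epsilon>"
    have R: "I_int p lam = {-R..R}"
      by (simp add: I_int_def R_def s_def)
    have c: "lam * f0 > 0" "\<And>x. x \<in> \<Omega> \<Longrightarrow> lam * f x \<ge> lam * f0"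
      using lam f0 by simp_all
    have b: "\<And>x. x \<in> frontier \<Omega> \<Longrightarrow> b x \<ge> 0" using assms(10) by blast
    have sol\<Phi>: "classical_solution \<Omega> \<nu> D (\<lambda>x s. lam * f x * (s - 1)) b (\<lambda>x. 0) (\<Phi> lam)"
      and sol\<Psi>: "classical_solution \<Omega> \<nu> D (\<lambda>x s. lam * f x * (s - 0)) b g (\<Psi> lam)"
      using assms(16,17) lam(1) by simp_all
    note nd\<Phi> = classical_solution_nondivergence[OF sol\<Phi> assms(4)]
    note nd\<Psi> = classical_solution_nondivergence[OF sol\<Psi> assms(4), simplified]
    \<comment> \<open>Since \<open>\<delta>\<close> squared is \<open>lam powr (- 5 / 8)\<close>,
      the product of \<open>lam\<close> with it is \<open>lam powr (3 / 8)\<close>.\<close>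
    have eps: "4 * M * K / (lam * f0 * \<delta>\<^sup>2) = \<epsilon>"
    proof -
      have "lam * \<delta>\<^sup>2 = lam powr 1 * (lam powr (- 5 / 16) * lam powr (- 5 / 16))"
        using lam by (simp add: \<delta>_def power2_eq_square)
      also have "\<dots> = lam powr (3 / 8)" unfolding powr_add[symmetric] by simp
      finally have "4 * M * K / (lam * f0 * \<delta>\<^sup>2) = C / lam powr (3 / 8)"
        by (simp add: C_def mult_ac)
      then show ?thesis by (simp add: \<epsilon>_def powr_minus_divide)
    qed
    have \<epsilon>0: "\<epsilon> \<ge> 0" using M(1) K0 f0(1) by (simp add: \<epsilon>_def C_def)
    \<comment> \<open>The shifted datum -1 lies below \<open>M = 0\<close>, so the one-sided
      principle gives \<open>\<Phi> \<le> 1\<close>; the symmetric bound \<open>\<Phi>2\<close> only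
      adds \<open>0 \<le> \<Phi>\<close>.\<close>
    have \<Phi>1: "\<Phi> lam x - 1 \<le> 0" if "x \<in> closure \<Omega>" for x
      by (rule maximum_principle[OF \<Omega>(1,2) assms(2) nd\<Phi>(2,1,3) pd _ b _ _ that])
        (use lam(1) assms(8) sub in auto)
    have \<Phi>2: "\<bar>\<Phi> lam x - 1\<bar> \<le> 1" if "x \<in> closure \<Omega>" for x
      by (rule robin_solution_estimates(1)[OF assms(1,2) pd K c b _ _ nd\<Phi>(2,1,3) that]) auto
    have \<Psi>: "\<bar>\<Psi> lam x\<bar> \<le> M" if "x \<in> closure \<Omega>" for x
      by (rule robin_solution_estimates(1)[OF assms(1,2) pd K c b M(2) _ nd\<Psi>(2,1,3) that]) (use M(1) in auto)
    have off: "\<bar>\<Phi> lam x - 1\<bar> \<le> \<epsilon>" "\<bar>\<Psi> lam x\<bar> \<le> \<epsilon>" if x: "x \<in> \<Omega> - E" for x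
    proof -
      have x: "x \<in> \<Omega>" "x \<notin> boundary_layer \<Omega> \<delta>" using x by (auto simp: E_def)
      show "\<bar>\<Phi> lam x - 1\<bar> \<le> \<epsilon>" unfolding eps[symmetric]
        by (rule robin_solution_estimates(2)[OF assms(1,2) pd K c b _ _ nd\<Phi>(2,1,3) x \<delta>]) (use M(1) in auto)
      show "\<bar>\<Psi> lam x\<bar> \<le> \<epsilon>" unfolding eps[symmetric]
        by (rule robin_solution_estimates(2)[OF assms(1,2) pd K c b M(2) _ nd\<Psi>(2,1,3) x \<delta>]) (use M(1) in auto)
    qed
    have "open (boundary_layer \<Omega> \<delta>)" by (auto simp: boundary_layer_def)
    then have E: "E \<in> sets lebesgue" "E \<subseteq> \<Omega>" using \<Omega>(1) by (auto simp: E_def)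
    have Em: "measure lebesgue E \<le> K1 * \<delta>"
    proof -
      have "boundary_layer \<Omega> \<delta> \<in> lmeasurable"
        unfolding boundary_layer_def
        by (intro lmeasurable_thickening compact_imp_bounded compact_frontier_bounded \<Omega>(2))
      then have "measure lebesgue E \<le> measure lebesgue (boundary_layer \<Omega> \<delta>)"
        using E by (intro measure_mono_fmeasurable) (auto simp: E_def)
      then show ?thesis using K1(2)[OF \<delta>] by linarith
    qed
    have "(LINT x|lebesgue_on \<Omega>. indicat_real E x * \<bar>w x\<bar>) \<le> A * (K1 * \<delta>) powr (1 - recip p)"
      unfolding A_def using K1(1) \<delta>(1) by (intro integral_abs_le_Lp_norm[OF assms(12,13) wi lm E Em]) auto
    also have "\<dots> = \<eta>"
      using K1(1) \<delta>(1) by (simp add: \<eta>_def H_def \<delta>_def powr_mult powr_powr flip: s_def)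
    finally have \<eta>: "(LINT x|lebesgue_on \<Omega>. indicat_real E x * \<bar>w x\<bar>) \<le> \<eta>" .
    have meas: "u \<in> borel_measurable (lebesgue_on \<Omega>)" if "continuous_on (closure \<Omega>) u" for u :: "real^'n \<Rightarrow> real"
      using continuous_on_subset[OF that sub] fmeasurableD[OF lm] by (rule continuous_imp_measurable_on_sets_lebesgue)
    have m\<Phi>: "\<Phi> lam \<in> borel_measurable (lebesgue_on \<Omega>)" and m\<Psi>: "\<Psi> lam \<in> borel_measurable (lebesgue_on \<Omega>)"
      using sol\<Phi> sol\<Psi> by (auto simp: classical_solution_def intro: meas)
    have par: "R \<le> 1" "\<rho> \<le> d" "\<rho> * W + B * \<eta> \<le> d" "L * \<rho> * W + L' * B * \<eta> \<le> R" "L * W + L' * \<eta> < 1"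
      using lam1[OF lam(3) R_def \<epsilon>_def \<eta>_def \<rho>_def] by blast+
    have \<phi>: "0 \<le> \<Phi> lam x \<and> \<Phi> lam x \<le> 1" if "x \<in> \<Omega>" for x
      using \<Phi>1[of x] \<Phi>2[of x] sub that by (auto simp: abs_le_iff)
    have \<psi>: "\<bar>\<Psi> lam x\<bar> \<le> M" if "x \<in> \<Omega>" for x using \<Psi> sub that by blast
    have R0: "0 \<le> R" "0 \<le> M" "L \<le> L'" using M(1) by (auto simp: R_def L'_def)
    note fp = nonlocal_fixed_point[OF lm E m\<Phi> m\<Psi> \<phi> \<psi> off \<epsilon>0 wi assms(14) W \<eta> r N L(1,3) B_def R0(2,3) L'
        R0(1) par(1) \<rho>_def par(2-5)]
    show "\<forall>\<theta>\<in>I_int p lam. nonlocal_defined ty \<Omega> w N (\<lambda>y. (r + \<theta>) * \<Phi> lam y + \<Psi> lam y)"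
      unfolding R using fp(1) by blast
    show "T_map ty \<Omega> w N (\<Phi> lam) (\<Psi> lam) r ` I_int p lam \<subseteq> I_int p lam"
      unfolding R by (rule fp(2))
    show "\<exists>!\<theta>. \<theta> \<in> I_int p lam \<and> T_map ty \<Omega> w N (\<Phi> lam) (\<Psi> lam) r \<theta> = \<theta>"
      unfolding R by (rule fp(3))
  qed simp
qed

end
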